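(* Let $d\ge 1$, let $R$ be a real $d\times d$ matrix all of whose eigenvalues $\lambda$ satisfy $|\lambda|>1$, let $S=R^t$ be its transpose, and let $B,L\subset\mathbb{R}^d$ be finite sets such that (a) $\#B=\#L=:N$ and the matrix $\frac{1}{\sqrt N}\left(e^{2\pi i (R^{-1}b)\cdot l}\right)_{b\in B,\,l\in L}$ is unitary; (b) $R^n b\cdot l\in\mathbb{Z}$ for all $b\in B$, $l\in L$, $n\ge 0$; (c) $0\in B$ and $0\in L$. Let $W_B(x)=\left|\frac1N\sum_{b\in B}e^{2\pi i b\cdot x}\right|^2$, let $\mu_B$ be the invariant probability measure of the IFS $(\tau_b)_{b\in B}$, and suppose that $W_B$ satisfies the transversality of the zeroes condition (TZ) with respect to the IFS $(\tau_l)_{l\in L}$ on its attractor $X_L$. Let $\Lambda\subset\mathbb{R}^d$ be the smallest set that contains $-C$ for all $W_B$-cycles $C$ and such that $S\Lambda+L\subset\Lambda$. Then $$\{e^{2\pi i\lambda\cdot x}\mid \lambda\in\Lambda\}$$ is an orthonormal basis for $L^2(\mu_B)$.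
   Context: For $b\in B$ put $\tau_b(x)=R^{-1}(x+b)$, $x\in\mathbb{R}^d$; $\mu_B$ is the unique compactly supported Borel probability measure on $\mathbb{R}^d$ with $\mu_B=\frac1N\sum_{b\in B}\mu_B\circ\tau_b^{-1}$. For $l\in L$ put $\tau_l(x)=S^{-1}(x+l)$; $X_L$ is the attractor of $(\tau_l)_{l\in L}$, i.e. the unique nonempty compact set with $X_L=\bigcup_{l\in L}\tau_l(X_L)$. Let $\Omega=L^{\{1,2,\dots\}}$, let $r_\Omega(\omega_1,\omega_2,\dots)=(\omega_2,\omega_3,\dots)$ be the shift, and let $\pi:\Omega\to X_L$, $\pi(\omega)=\lim_{n}\tau_{\omega_1}\cdots\tau_{\omega_n}x_0$ (independent of $x_0$). Cycles: a cycle is a set $C=\pi(\{\omega,r_\Omega\omega,\dots,r_\Omega^{p-1}\omega\})$ where $\omega\in\Omega$ satisfies $r_\Omega^p\omega=\omega$ for some $p\geq 1$. A $W_B$-cycle is a cycle $C$ such that $W_B(y)=1$ for all $y\in C$. Here $-C=\{-y\mid y\in C\}$. For $x\in X_L$, $n\ge 0$, write $r^{-n}(x)=\{\tau_{\omega_1}\cdots\tau_{\omega_n}x\mid\omega_1,\dots,\omega_n\in L\}$. Condition (TZ) for $W=W_B$: (i) if $x\in X_L$ is not a point of a cycle, then there is $n_x\ge 0$ such that for all $n\ge n_x$ the set $r^{-n}(x)$ contains no zeroes of $W$; (ii) for every shift-periodic $\omega\in\Omega$, with $x_0=\pi(r_\Omega\omega)$ (so that $x_1=\tau_{\omega_1}x_0=\pi(\omega)$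 is the next point of the cycle), and every $j\in L$, $j\ne\omega_1$, the point $\tau_jx_0$ either is not a point of a cycle or satisfies $W(\tau_jx_0)=0$. *)

theory Defs
  imports "HOL-Probability.Probability"
begin

definition complex_eigenvalue :: "real^'n^'n \<Rightarrow> complex \<Rightarrow> bool" where
  "complex_eigenvalue R z \<longleftrightarrow>
     (\<exists>v :: complex^'n. v \<noteq> 0 \<and> map_matrix complex_of_real R *v v = z *s v)"

definition expo :: "real^'n \<Rightarrow> real^'n \<Rightarrow> complex" where
  "expo l x = exp (2 * complex_of_real pi * \<i> * complex_of_real (l \<bullet> x))"

text \<open>Unitarity of a matrix \<open>U\<close> whose rows are indexed by \<open>I\<close> and columns by \<open>J\<close>:
  \<open>U U* = 1\<close> and \<open>U* U = 1\<close>.\<close>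

definition unitary_on :: "'a set \<Rightarrow> 'b set \<Rightarrow> ('a \<Rightarrow> 'b \<Rightarrow> complex) \<Rightarrow> bool" where
  "unitary_on I J U \<longleftrightarrow>
     (\<forall>i\<in>I. \<forall>i'\<in>I. (\<Sum>j\<in>J. U i j * cnj (U i' j)) = (if i = i' then 1 else 0)) \<and>
     (\<forall>j\<in>J. \<forall>j'\<in>J. (\<Sum>i\<in>I. cnj (U i j) * U i j') = (if j = j' then 1 else 0))"

definition tau :: "real^'n^'n \<Rightarrow> real^'n \<Rightarrow> real^'n \<Rightarrow> real^'n" where
  "tau A v x = matrix_inv A *v (x + v)"

definition invariant_measure :: "real^'n^'n \<Rightarrow> (real^'n) set \<Rightarrow> (real^'n) measure \<Rightarrow> bool" where
  "invariant_measure R B M \<longleftrightarrow>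
     prob_space M \<and> sets M = sets borel \<and>
     (\<exists>K. compact K \<and> measure M (- K) = 0) \<and>
     (\<forall>A\<in>sets borel.
        measure M A = (1 / real (card B)) * (\<Sum>b\<in>B. measure M (tau R b -` A)))"

definition attractor :: "real^'n^'n \<Rightarrow> (real^'n) set \<Rightarrow> (real^'n) set \<Rightarrow> bool" where
  "attractor S L X \<longleftrightarrow> X \<noteq> {} \<and> compact X \<and> X = (\<Union>l\<in>L. tau S l ` X)"

text \<open>Sequences are indexed from \<open>0\<close>: \<open>\<omega> k\<close> stands for the letter \<open>\<omega>\<^sub>k\<^sub>+\<^sub>1\<close>.\<close>

definition Omega :: "'a set \<Rightarrow> (nat \<Rightarrow> 'a) set" where
  "Omega L = {\<omega>. \<forall>k. \<omega> k \<in> L}"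

definition shift :: "(nat \<Rightarrow> 'a) \<Rightarrow> nat \<Rightarrow> 'a" where
  "shift \<omega> = (\<lambda>k. \<omega> (Suc k))"

text \<open>The limit defining the coding map does not depend on the starting point, which is
  taken to be \<open>0\<close>.\<close>

definition coding :: "real^'n^'n \<Rightarrow> (nat \<Rightarrow> real^'n) \<Rightarrow> real^'n" where
  "coding S \<omega> = lim (\<lambda>n. foldr (tau S) (map \<omega> [0..<n]) 0)"

definition is_cycle :: "real^'n^'n \<Rightarrow> (real^'n) set \<Rightarrow> (real^'n) set \<Rightarrow> bool" where
  "is_cycle S L C \<longleftrightarrow>
     (\<exists>\<omega>\<in>Omega L. \<exists>p\<ge>1. (shift ^^ p) \<omega> = \<omega> \<and> C = coding S ` {(shift ^^ k) \<omega> | k. k < p})"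

definition cycle_point :: "real^'n^'n \<Rightarrow> (real^'n) set \<Rightarrow> real^'n \<Rightarrow> bool" where
  "cycle_point S L x \<longleftrightarrow> (\<exists>C. is_cycle S L C \<and> x \<in> C)"

definition preimages :: "real^'n^'n \<Rightarrow> (real^'n) set \<Rightarrow> nat \<Rightarrow> real^'n \<Rightarrow> (real^'n) set" where
  "preimages S L n x = {foldr (tau S) ls x | ls. set ls \<subseteq> L \<and> length ls = n}"

definition W :: "(real^'n) set \<Rightarrow> real^'n \<Rightarrow> real" where
  "W B x = (cmod (1 / of_nat (card B) * (\<Sum>b\<in>B. expo b x)))\<^sup>2"

definition W_cycle ::
  "(real^'n) set \<Rightarrow> real^'n^'n \<Rightarrow> (real^'n) set \<Rightarrow> (real^'n) set \<Rightarrow> bool" where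
  "W_cycle B S L C \<longleftrightarrow> is_cycle S L C \<and> (\<forall>y\<in>C. W B y = 1)"

definition TZ ::
  "(real^'n \<Rightarrow> real) \<Rightarrow> real^'n^'n \<Rightarrow> (real^'n) set \<Rightarrow> (real^'n) set \<Rightarrow> bool" where
  "TZ w S L X \<longleftrightarrow>
     (\<forall>x\<in>X. \<not> cycle_point S L x \<longrightarrow>
        (\<exists>n\<^sub>x. \<forall>n\<ge>n\<^sub>x. \<forall>y\<in>preimages S L n x. w y \<noteq> 0)) \<and>
     (\<forall>\<omega>\<in>Omega L. (\<exists>p\<ge>1. (shift ^^ p) \<omega> = \<omega>) \<longrightarrow>
        (\<forall>j\<in>L. j \<noteq> \<omega> 0 \<longrightarrow>
           \<not> cycle_point S L (tau S j (coding S (shift \<omega>))) \<or>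
           w (tau S j (coding S (shift \<omega>))) = 0))"

definition spectrum_set ::
  "(real^'n) set \<Rightarrow> real^'n^'n \<Rightarrow> (real^'n) set \<Rightarrow> (real^'n) set" where
  "spectrum_set B S L =
     \<Inter>{\<Lambda>. (\<forall>C. W_cycle B S L C \<longrightarrow> uminus ` C \<subseteq> \<Lambda>) \<and>
         {S *v t + l | t l. t \<in> \<Lambda> \<and> l \<in> L} \<subseteq> \<Lambda>}"

definition L2_fun :: "'a measure \<Rightarrow> ('a \<Rightarrow> complex) \<Rightarrow> bool" where
  "L2_fun M f \<longleftrightarrow> f \<in> borel_measurable M \<and> integrable M (\<lambda>x. (cmod (f x))\<^sup>2)"

text \<open>Elements of \<open>L\<^sup>2(M)\<close> are represented by functions.  Members of \<open>F\<close> that differ as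
  functions are required to be orthogonal, so they are in particular distinct modulo
  \<open>M\<close>-null sets.  The last clause is density of the complex linear span of \<open>F\<close> in the
  \<open>L\<^sup>2\<close>-norm.\<close>

definition orthonormal_basis_L2 :: "'a measure \<Rightarrow> ('a \<Rightarrow> complex) set \<Rightarrow> bool" where
  "orthonormal_basis_L2 M F \<longleftrightarrow>
     (\<forall>f\<in>F. L2_fun M f) \<and>
     (\<forall>f\<in>F. \<forall>g\<in>F. (LINT x|M. f x * cnj (g x)) = (if f = g then 1 else 0)) \<and>
     (\<forall>h. L2_fun M h \<longrightarrow>
        (\<forall>\<epsilon>>0. \<exists>T c. finite T \<and> T \<subseteq> F \<and>
           sqrt (LINT x|M. (cmod (h x - (\<Sum>f\<in>T. c f * f x)))\<^sup>2) < \<epsilon>))"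

end

theory Submission
  imports Defs "HOL-Computational_Algebra.Fundamental_Theorem_Algebra"
begin

text \<open>
  Write \<open>m\<close> for the Fourier transform of \<open>\<mu>\<close>; invariance of \<open>\<mu>\<close> gives
  \<open>m y = mask B (S\<inverse> y) * m (S\<inverse> y)\<close>, where \<open>W B\<close> is the squared modulus of \<open>mask B\<close>.
  Orthogonality: points of \<open>\<Lambda>\<close> pair integrally with \<open>B\<close>, so \<open>m ((S t + l) - (S t' + l'))\<close>
  vanishes if \<open>l \<noteq> l'\<close> and is \<open>m (t - t')\<close> otherwise; stripping digits reduces to two cycle
  points, where equality of all digits forces equality of the points.

  Completeness: the energy \<open>h x\<close>, the sum of \<open>(cmod (m (x + t)))\<^sup>2\<close> over \<open>t \<in> \<Lambda>\<close>, is at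
  most \<open>1\<close> (Bessel), lower semicontinuous and superharmonic for the transition probabilities
  \<open>W B (tau S l x)\<close>, and it is \<open>1\<close> on \<open>W\<close>-cycles. Its minimum over \<open>X\<close> propagates along
  transitions of positive probability. If it is attained at a point outside the cycles, then
  by (TZ) all late descendants of some minimum point are minimum points, hence so is their
  limit \<open>0\<close>, which is a \<open>W\<close>-cycle. If it is attained at cycle points only, then (TZ) leaves
  just the transition along the cycle, which is therefore a \<open>W\<close>-cycle. So \<open>h \<ge> 1\<close> on \<open>X\<close>, and
  on the whole space because \<open>X\<close> attracts. Hence every exponential, and by Stone-Weierstrass
  every square-integrable function, is a limit of linear combinations from \<open>\<Lambda>\<close>.
\<close>

section \<open>Iterates of the inverse of an expanding matrix\<close>

text \<open>The scalar core of the decay of matrix iterates: \<open>w\<close> follows one coordinate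
  of the iterates of \<open>v\<close>, and \<open>u\<close> the same coordinate of the iterates of
  \<open>A v - z v\<close>.\<close>

lemma perturbed_contraction_tendsto_0:
  fixes w u :: "nat \<Rightarrow> complex"
  assumes rec: "\<And>n. w (Suc n) = z * w n + u n" and z: "cmod z < 1" and u: "u \<longlonglongrightarrow> 0"
  shows "w \<longlonglongrightarrow> 0"
proof (rule LIMSEQ_I)
  fix e :: real assume e: "0 < e"
  \<comment> \<open>With this \<open>d\<close>, the number \<open>e / 2\<close> is the fixed point
    of \<open>x \<mapsto> cmod z * x + d\<close>, so the summand \<open>e / 2\<close> reproduces
    itself in the induction.\<close>
  define d where "d = e / 2 * (1 - cmod z)"
  have "0 < d" using e z by (simp add: d_def)
  then obtain n0 where n0: "\<And>n. n \<ge> n0 \<Longrightarrow> cmod (u n) < d"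
    using LIMSEQ_D[OF u] by auto
  have bd: "cmod (w (n0 + k)) \<le> cmod z ^ k * cmod (w n0) + e / 2" for k
  proof (induction k)
    case 0
    then show ?case using e by simp
  next
    case (Suc k)
    have "cmod (w (n0 + Suc k)) \<le> cmod z * cmod (w (n0 + k)) + d"
      using rec[of "n0 + k"] norm_triangle_ineq[of "z * w (n0 + k)" "u (n0 + k)"] n0[of "n0 + k"]
      by (simp add: norm_mult)
    also have "\<dots> \<le> cmod z * (cmod z ^ k * cmod (w n0) + e / 2) + d"
      using Suc by (simp add: mult_left_mono)
    also have "\<dots> = cmod z ^ Suc k * cmod (w n0) + e / 2"
      by (simp add: d_def field_simps)
    finally show ?case .
  qed
  have "(\<lambda>k. cmod z ^ k * cmod (w n0)) \<longlonglongrightarrow> 0 * cmod (w n0)"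
    by (intro tendsto_mult LIMSEQ_power_zero tendsto_const) (use z in simp)
  then obtain k0 where k0: "\<And>k. k \<ge> k0 \<Longrightarrow> \<bar>cmod z ^ k * cmod (w n0)\<bar> < e / 2"
    using LIMSEQ_D[of _ 0 "e / 2"] e by (metis (no_types, lifting) diff_zero half_gt_zero mult_zero_left real_norm_def)
  show "\<exists>no. \<forall>n\<ge>no. norm (w n - 0) < e"
  proof (intro exI allI impI)
    fix n assume "n0 + k0 \<le> n"
    then obtain k where "n = n0 + k" "k \<ge> k0" by (metis add.assoc le_add1 le_iff_add)
    then show "norm (w n - 0) < e" using bd[of k] k0[of k] by simp
  qed
qed

text \<open>This is \<open>p(A) v\<close>, evaluated by Horner's scheme on vectors, so that no
  powers of the matrix itself have to be formed.\<close>

definition poly_act :: "complex^'n^'n \<Rightarrow> complex poly \<Rightarrow> complex^'n \<Rightarrow> complex^'n" where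
  "poly_act A p v = fold_coeffs (\<lambda>a w. a *s v + A *v w) p 0"

lemma poly_act_0 [simp]: "poly_act A 0 v = 0"
  by (simp add: poly_act_def)

lemma poly_act_pCons [simp]: "poly_act A (pCons a p) v = a *s v + A *v poly_act A p v"
  by (cases "p = 0 \<and> a = 0") (auto simp: poly_act_def)

lemma poly_act_add: "poly_act A (p + q) v = poly_act A p v + poly_act A q v"
  by (induction p q rule: poly_induct2)
     (auto simp: matrix_vector_right_distrib vec.scale_left_distrib)

lemma poly_act_smult: "poly_act A (smult c p) v = c *s poly_act A p v"
  by (induction p) (auto simp: vector_ssub_ldistrib vec.scale_right_distrib
      matrix_vector_mult_scaleR vec.linear_scale vector_scalar_commute)

lemma poly_act_sum: "poly_act A (\<Sum>i\<in>I. p i) v = (\<Sum>i\<in>I. poly_act A (p i) v)"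
  by (induction I rule: infinite_finite_induct) (auto simp: poly_act_add)

lemma poly_act_monom: "poly_act A (monom c i) v = c *s ((*v) A ^^ i) v"
  by (induction i) (auto simp: monom_0 monom_Suc vector_scalar_commute)

lemma poly_act_linear_factor:
  "poly_act A ([:-z, 1:] * p) v = A *v poly_act A p v - z *s poly_act A p v"
proof -
  have "[:-z, 1:] * p = smult (-z) p + pCons 0 p" by simp
  then show ?thesis by (simp only: poly_act_add poly_act_smult) simp
qed

text \<open>Polynomials in \<open>A\<close> commute with \<open>A - z\<close>, so a linear factor of
  an annihilating polynomial can be moved onto the vector.\<close>

lemma poly_act_shifted:
  "poly_act A p (A *v v - z *s v) = A *v poly_act A p v - z *s poly_act A p v"
proof (induction p)
  case (pCons a p)
  show ?case unfolding poly_act_pCons pCons.IH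
    by (simp only: matrix_vector_mult_diff_distrib matrix_vector_right_distrib vector_scalar_commute)
       (simp add: vec_eq_iff right_diff_distrib distrib_left mult.left_commute)
qed simp

text \<open>The vectors \<open>v\<close>, \<open>A v\<close>, ... up to the power
  \<open>CARD('n)\<close> are one more than the dimension, and a linear relation among them is a
  polynomial annihilating \<open>v\<close>.\<close>

lemma ex_annihilating_poly:
  fixes A :: "complex^'n^'n"
  shows "\<exists>p. p \<noteq> 0 \<and> poly_act A p v = 0"
proof -
  define f where "f i = ((*v) A ^^ i) v" for i
  define I where "I = {..CARD('n)}"
  show ?thesis
  proof (cases "inj_on f I")
    case False
    then obtain i j where ij: "i \<noteq> j" "f i = f j" by (auto simp: inj_on_def)
    have "coeff (monom 1 i + monom (-1) j :: complex poly) i \<noteq> 0" using ij by simp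
    then have "monom 1 i + monom (-1) j \<noteq> (0 :: complex poly)" by (metis coeff_0)
    moreover have "poly_act A (monom 1 i + monom (-1) j) v = 0"
      using ij by (simp add: poly_act_add poly_act_monom f_def)
    ultimately show ?thesis by blast
  next
    case True
    have "card (f ` I) = CARD('n) + 1" using True by (simp add: card_image I_def)
    then have "vec.dependent (f ` I)"
      using vec.independent_card_le_dim[of "f ` I" UNIV]
      by (metis Suc_eq_plus1 not_less_eq_eq order_refl subset_UNIV vec.dim_UNIV  vec_dim_card)
    then obtain u where u: "(\<Sum>w\<in>f ` I. u w *s w) = 0" "\<exists>w\<in>f ` I. u w \<noteq> 0"
      using vec.dependent_finite[of "f ` I"] by (auto simp: I_def)
    define p where "p = (\<Sum>i\<in>I. monom (u (f i)) i)"
    have "poly_act A p v = (\<Sum>i\<in>I. u (f i) *s f i)"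
      by (simp add: p_def poly_act_sum poly_act_monom f_def)
    also have "\<dots> = 0" using u(1) True by (simp add: sum.reindex)
    finally have "poly_act A p v = 0" .
    moreover obtain i where i: "i \<in> I" "u (f i) \<noteq> 0" using u(2) by auto
    have "coeff p i = u (f i)"
      using i by (simp add: p_def coeff_sum I_def)
    then have "p \<noteq> 0" using i by auto
    ultimately show ?thesis by blast
  qed
qed

lemma funpow_matrix_vector_diff:
  fixes A :: "complex^'n^'n"
  shows "((*v) A ^^ n) (x - y) = ((*v) A ^^ n) x - ((*v) A ^^ n) y"
  by (induction n) (auto simp: matrix_vector_mult_diff_distrib)

lemma funpow_matrix_vector_scale:
  fixes A :: "complex^'n^'n"
  shows "((*v) A ^^ n) (c *s x) = c *s ((*v) A ^^ n) x"
  by (induction n) (auto simp: vector_scalar_commute)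

text \<open>Induction on the degree of a polynomial \<open>p\<close> annihilating \<open>v\<close>. Let \<open>p = (x - z) q\<close>. Either
  \<open>q\<close> annihilates \<open>v\<close>, or \<open>z\<close> is an eigenvalue; then the iterates of \<open>A v - z v\<close>, which \<open>q\<close>
  annihilates, tend to \<open>0\<close>, and so do those of \<open>v\<close> because \<open>cmod z < 1\<close>.\<close>

lemma matrix_iterates_tendsto_0:
  fixes A :: "complex^'n^'n"
  assumes ev: "\<And>z v. v \<noteq> 0 \<Longrightarrow> A *v v = z *s v \<Longrightarrow> cmod z < 1"
  shows "(\<lambda>n. ((*v) A ^^ n) v) \<longlonglongrightarrow> 0"
proof -
  have *: "(\<lambda>n. ((*v) A ^^ n) v) \<longlonglongrightarrow> 0" if "p \<noteq> 0" "poly_act A p v = 0" for p v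
    using that
  proof (induction "degree p" arbitrary: p v)
    case 0
    then obtain a where "p = [:a:]" "a \<noteq> 0" by (metis degree_eq_zeroE pCons_0_0)
    then have "v = 0" using 0 by auto
    moreover have "((*v) A ^^ n) 0 = 0" for n by (induction n) auto
    ultimately show ?case by simp
  next
    case (Suc k)
    have "\<not> constant (poly p)" using Suc.hyps(2) by (simp add: constant_degree)
    then obtain z where "poly p z = 0" using fundamental_theorem_of_algebra by blast
    then obtain q where q: "p = [:-z, 1:] * q" by (metis dvdE poly_eq_0_iff_dvd)
    with Suc have "q \<noteq> 0" by auto
    then have "degree p = Suc (degree q)" unfolding q by (subst degree_mult_eq) auto
    then have k: "k = degree q" using Suc.hyps(2) by simp
    let ?u = "A *v v - z *s v"
    have u0: "poly_act A q ?u = 0"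
      using Suc.prems(2) unfolding q by (simp only: poly_act_linear_factor poly_act_shifted)
    show ?case
    proof (cases "poly_act A q v = 0")
      case True
      then show ?thesis using Suc.hyps(1) k \<open>q \<noteq> 0\<close> by blast
    next
      case False
      have z: "cmod z < 1"
        using ev[OF False, of z] Suc.prems(2) unfolding q by (simp add: poly_act_linear_factor del: mult_pCons_left)
      have "(\<lambda>n. ((*v) A ^^ n) ?u) \<longlonglongrightarrow> 0"
        using Suc.hyps(1)[OF k \<open>q \<noteq> 0\<close> u0] .
      then have u: "(\<lambda>n. (((*v) A ^^ n) ?u) $ i) \<longlonglongrightarrow> 0" for i
        using tendsto_vec_nth by fastforce
      have "((*v) A ^^ Suc n) v = z *s ((*v) A ^^ n) v + ((*v) A ^^ n) ?u" for n
        by (simp add: funpow_matrix_vector_diff funpow_matrix_vector_scale funpow_swap1)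
      then have "(((*v) A ^^ Suc n) v) $ i = z * (((*v) A ^^ n) v) $ i + (((*v) A ^^ n) ?u) $ i" for n i
        by (metis vector_add_component vector_smult_component)
      then have "(\<lambda>n. (((*v) A ^^ n) v) $ i) \<longlonglongrightarrow> 0" for i
        by (rule perturbed_contraction_tendsto_0[OF _ z u[of i]])
      then show ?thesis by (intro vec_tendstoI) simp
    qed
  qed
  then show ?thesis using ex_annihilating_poly[of A v] by blast
qed

section \<open>Expanding real matrices and their transposes\<close>

text \<open>A nonzero real vector in the kernel would, read as a complex vector, be an eigenvector
  for the eigenvalue \<open>0\<close>.\<close>

lemma invertible_of_expanding:
  fixes R :: "real^'n^'n"
  assumes "\<And>z. complex_eigenvalue R z \<Longrightarrow> cmod z > 1"
  shows "invertible R"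
proof -
  have "x = 0" if x: "R *v x = 0" for x
  proof (rule ccontr)
    assume "x \<noteq> 0"
    define v :: "complex^'n" where "v = (\<chi> i. of_real (x $ i))"
    have "v \<noteq> 0" using \<open>x \<noteq> 0\<close> by (auto simp: v_def vec_eq_iff)
    moreover have "map_matrix complex_of_real R *v v = 0 *s v"
    proof -
      have "(\<Sum>j\<in>UNIV. R $ i $ j * x $ j) = 0" for i
        using x by (simp add: vec_eq_iff matrix_vector_mult_def)
      then have "(\<Sum>j\<in>UNIV. complex_of_real (R $ i $ j) * of_real (x $ j)) = 0" for i
        by (metis (mono_tags, lifting) of_real_0 of_real_mult of_real_sum sum.cong)
      then show ?thesis by (simp add: vec_eq_iff matrix_vector_mult_def v_def map_matrix_def)
    qed
    ultimately have "complex_eigenvalue R 0" unfolding complex_eigenvalue_def by blast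
    then show False using assms by fastforce
  qed
  then show ?thesis
    using matrix_left_invertible_ker[of R] invertible_left_inverse[of R] by auto
qed

lemma matrix_inv_mult:
  fixes A :: "real^'n^'n"
  assumes "invertible A"
  shows matrix_inv_mult_right: "A ** matrix_inv A = mat 1"
    and matrix_inv_mult_left: "matrix_inv A ** A = mat 1"
  using assms someI_ex[of "\<lambda>A'. A ** A' = mat 1 \<and> A' ** A = mat 1"]
  by (auto simp: invertible_def matrix_inv_def)

text \<open>The complexified inverse has only reciprocals of eigenvalues of \<open>R\<close> as
  eigenvalues, all inside the unit disc. The complex decay result is then pulled back coordinate by
  coordinate.\<close>

lemma inverse_iterates_tendsto_0:
  fixes R :: "real^'n^'n"
  assumes ex: "\<And>z. complex_eigenvalue R z \<Longrightarrow> cmod z > 1"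
  shows "(\<lambda>n. ((*v) (matrix_inv R) ^^ n) x) \<longlonglongrightarrow> 0"
proof -
  let ?c = "map_matrix complex_of_real :: real^'n^'n \<Rightarrow> complex^'n^'n"
  define A where "A = ?c (matrix_inv R)"
  have mult: "?c P ** ?c Q = ?c (P ** Q)" for P Q
    by (simp add: vec_eq_iff matrix_matrix_mult_def map_matrix_def)
  have RA: "?c R ** A = mat 1"
  proof -
    have "R ** matrix_inv R = mat 1"
      using invertible_of_expanding[OF ex] matrix_inv_mult_right by blast
    then show ?thesis by (simp add: A_def mult) (simp add: vec_eq_iff mat_def map_matrix_def)
  qed
  have ev: "cmod z < 1" if "v \<noteq> 0" "A *v v = z *s v" for z v
  proof -
    have v: "v = z *s (?c R *v v)"
      using RA that by (metis matrix_vector_mul_assoc matrix_vector_mul_lid vector_scalar_commute)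
    then have "z \<noteq> 0" using that by auto
    with v have "?c R *v v = (1 / z) *s v"
      by (metis (no_types, lifting) nonzero_eq_divide_eq mult.commute vec.scale_one vec.scale_scale)
    then have "complex_eigenvalue R (1 / z)" using that unfolding complex_eigenvalue_def by blast
    then have "1 < cmod (1 / z)" by (rule ex)
    then show ?thesis using \<open>z \<noteq> 0\<close> by (simp add: norm_divide field_simps)
  qed
  define cv :: "real^'n \<Rightarrow> complex^'n" where "cv x = (\<chi> i. of_real (x $ i))" for x
  have step: "A *v cv x = cv (matrix_inv R *v x)" for x
    by (simp add: vec_eq_iff cv_def A_def matrix_vector_mult_def map_matrix_def)
  have it: "((*v) A ^^ n) (cv x) = cv (((*v) (matrix_inv R) ^^ n) x)" for n
    by (induction n) (auto simp: step)
  have "(\<lambda>n. cv (((*v) (matrix_inv R) ^^ n) x)) \<longlonglongrightarrow> 0"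
    using matrix_iterates_tendsto_0[of A "cv x", OF ev] by (simp add: it)
  then have "(\<lambda>n. cv (((*v) (matrix_inv R) ^^ n) x) $ i) \<longlonglongrightarrow> 0" for i
    using tendsto_vec_nth by fastforce
  then have "(\<lambda>n. complex_of_real ((((*v) (matrix_inv R) ^^ n) x) $ i)) \<longlonglongrightarrow> of_real 0" for i
    by (simp add: cv_def)
  then have "(\<lambda>n. (((*v) (matrix_inv R) ^^ n) x) $ i) \<longlonglongrightarrow> 0" for i
    by (simp only: tendsto_of_real_iff)
  then show ?thesis by (intro vec_tendstoI) simp
qed

lemma matrix_inv_transpose:
  fixes R :: "real^'n^'n"
  assumes "invertible R"
  shows "matrix_inv (transpose R) = transpose (matrix_inv R)"
proof -
  have "transpose (matrix_inv R) ** transpose R = mat 1"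
    using matrix_inv_mult_right[OF assms] by (metis matrix_transpose_mul transpose_mat)
  then show ?thesis
    using matrix_inv_mult_right[OF transpose_invertible[OF assms]]
    by (metis matrix_mul_assoc matrix_mul_lid matrix_mul_rid)
qed

lemma inner_funpow_transpose:
  fixes A :: "real^'n^'n"
  shows "((*v) (transpose A) ^^ n) x \<bullet> y = x \<bullet> ((*v) A ^^ n) y"
proof (induction n arbitrary: y)
  case (Suc n)
  show ?case
    using Suc[of "A *v y"] by (simp add: dot_lmul_matrix funpow_swap1)
qed simp

text \<open>The spectra of \<open>R\<close> and its transpose need not be compared: a coordinate is
  an inner product with a basis vector, and the iterates move to the other side of it.\<close>

lemma transpose_inverse_iterates_tendsto_0:
  fixes R :: "real^'n^'n"
  assumes ex: "\<And>z. complex_eigenvalue R z \<Longrightarrow> cmod z > 1"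
  shows "(\<lambda>n. ((*v) (matrix_inv (transpose R)) ^^ n) x) \<longlonglongrightarrow> 0"
proof (rule vec_tendstoI)
  fix i
  have "(\<lambda>n. x \<bullet> ((*v) (matrix_inv R) ^^ n) (axis i 1)) \<longlonglongrightarrow> x \<bullet> 0"
    by (intro tendsto_intros inverse_iterates_tendsto_0 ex)
  moreover have "x \<bullet> ((*v) (matrix_inv R) ^^ n) (axis i 1) = (((*v) (matrix_inv (transpose R)) ^^ n) x) $ i" for n
    by (simp add: matrix_inv_transpose invertible_of_expanding ex flip: inner_funpow_transpose)
       (simp add: inner_axis)
  ultimately show "(\<lambda>n. (((*v) (matrix_inv (transpose R)) ^^ n) x) $ i) \<longlonglongrightarrow> 0 $ i"
    by simp
qed

lemma matrix_vector_mult_minus: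
  fixes A :: "real^'n^'m"
  shows "A *v (- x) = - (A *v x)"
  using matrix_vector_mult_diff_distrib[of A 0 x] by simp


section \<open>Density of exponentials in \<open>L\<^sup>2\<close>\<close>

text \<open>Membership in the closed linear span of \<open>F\<close>. The squared distance is
  bounded instead of the distance, which avoids roots and gives the same closure.\<close>

definition L2_approx :: "'a measure \<Rightarrow> ('a \<Rightarrow> complex) set \<Rightarrow> ('a \<Rightarrow> complex) \<Rightarrow> bool" where
  "L2_approx M F f \<longleftrightarrow>
     (\<forall>\<epsilon>>0. \<exists>T c. finite T \<and> T \<subseteq> F \<and> (LINT x|M. (cmod (f x - (\<Sum>g\<in>T. c g * g x)))\<^sup>2) < \<epsilon>)"

lemma norm_add_squared_le: "(cmod (a + b))\<^sup>2 \<le> 2 * (cmod a)\<^sup>2 + 2 * (cmod b)\<^sup>2"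
proof -
  have "(cmod (a + b))\<^sup>2 \<le> (cmod a + cmod b)\<^sup>2"
    by (intro power_mono norm_triangle_ineq) simp
  also have "\<dots> \<le> 2 * (cmod a)\<^sup>2 + 2 * (cmod b)\<^sup>2"
    using zero_le_power2[of "cmod a - cmod b"] by (simp add: power2_sum power2_diff)
  finally show ?thesis .
qed

lemma L2_fun_add:
  assumes "L2_fun M f" "L2_fun M g"
  shows "L2_fun M (\<lambda>x. f x + g x)"
proof -
  have [measurable]: "f \<in> borel_measurable M" "g \<in> borel_measurable M"
    using assms by (auto simp: L2_fun_def)
  have "integrable M (\<lambda>x. 2 * (cmod (f x))\<^sup>2 + 2 * (cmod (g x))\<^sup>2)"
    using assms by (auto simp: L2_fun_def)
  then have "integrable M (\<lambda>x. (cmod (f x + g x))\<^sup>2)"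
    by (rule Bochner_Integration.integrable_bound) (auto simp: norm_add_squared_le)
  then show ?thesis by (simp add: L2_fun_def)
qed

lemma L2_fun_cmult: "L2_fun M f \<Longrightarrow> L2_fun M (\<lambda>x. c * f x)"
  by (auto simp: L2_fun_def norm_mult power_mult_distrib)

lemma L2_fun_diff: "L2_fun M f \<Longrightarrow> L2_fun M g \<Longrightarrow> L2_fun M (\<lambda>x. f x - g x)"
  using L2_fun_add[of M f "\<lambda>x. -1 * g x"] L2_fun_cmult[of M g "-1"] by simp

lemma L2_fun_sum:
  assumes "\<And>i. i \<in> I \<Longrightarrow> L2_fun M (f i)"
  shows "L2_fun M (\<lambda>x. \<Sum>i\<in>I. f i x)"
  using assms
proof (induction I rule: infinite_finite_induct)
  case (insert i I)
  then show ?case by (simp add: L2_fun_add)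
qed (auto simp: L2_fun_def)

lemma integral_norm_add_squared_le:
  assumes "L2_fun M f" "L2_fun M g"
  shows "(LINT x|M. (cmod (f x + g x))\<^sup>2)
           \<le> 2 * (LINT x|M. (cmod (f x))\<^sup>2) + 2 * (LINT x|M. (cmod (g x))\<^sup>2)"
proof -
  have i: "integrable M (\<lambda>x. (cmod (f x))\<^sup>2)" "integrable M (\<lambda>x. (cmod (g x))\<^sup>2)"
    "integrable M (\<lambda>x. (cmod (f x + g x))\<^sup>2)"
    using assms L2_fun_add[OF assms] by (auto simp: L2_fun_def)
  then have "(LINT x|M. (cmod (f x + g x))\<^sup>2) \<le> (LINT x|M. 2 * (cmod (f x))\<^sup>2 + 2 * (cmod (g x))\<^sup>2)"
    by (intro integral_mono norm_add_squared_le) auto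
  also have "\<dots> = 2 * (LINT x|M. (cmod (f x))\<^sup>2) + 2 * (LINT x|M. (cmod (g x))\<^sup>2)"
    using i by simp
  finally show ?thesis .
qed

lemma L2_approx_add:
  assumes F: "\<And>f. f \<in> F \<Longrightarrow> L2_fun M f"
    and f: "L2_fun M f" "L2_approx M F f" and g: "L2_fun M g" "L2_approx M F g"
  shows "L2_approx M F (\<lambda>x. f x + g x)"
  unfolding L2_approx_def
proof (intro allI impI)
  fix \<epsilon> :: real assume "0 < \<epsilon>"
  \<comment> \<open>Squared norms obey the triangle inequality only up to a factor \<open>2\<close>,
    hence a quarter for each summand.\<close>
  then have "0 < \<epsilon> / 4" by simp
  then obtain T c T' c' where T: "finite T" "T \<subseteq> F"
      "(LINT x|M. (cmod (f x - (\<Sum>g\<in>T. c g * g x)))\<^sup>2) < \<epsilon> / 4"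
    and T': "finite T'" "T' \<subseteq> F"
      "(LINT x|M. (cmod (g x - (\<Sum>g\<in>T'. c' g * g x)))\<^sup>2) < \<epsilon> / 4"
    using f(2) g(2) unfolding L2_approx_def by meson
  \<comment> \<open>\<open>T\<close> and \<open>T'\<close> may overlap, so coefficients of common
    members are added.\<close>
  define d where "d u = (if u \<in> T then c u else 0) + (if u \<in> T' then c' u else 0)" for u
  have d: "(\<Sum>u\<in>T \<union> T'. d u * u x) = (\<Sum>u\<in>T. c u * u x) + (\<Sum>u\<in>T'. c' u * u x)" for x
  proof -
    have "(\<Sum>u\<in>T \<union> T'. d u * u x)
        = (\<Sum>u\<in>T \<union> T'. if u \<in> T then c u * u x else 0) + (\<Sum>u\<in>T \<union> T'. if u \<in> T' then c' u * u x else 0)"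
      unfolding sum.distrib[symmetric] by (intro sum.cong) (auto simp: d_def distrib_right)
    then show ?thesis using T(1) T'(1) by (simp add: sum.If_cases Int_absorb1)
  qed
  let ?p = "\<lambda>x. f x - (\<Sum>u\<in>T. c u * u x)" and ?q = "\<lambda>x. g x - (\<Sum>u\<in>T'. c' u * u x)"
  have "L2_fun M ?p" "L2_fun M ?q"
    using T T' F by (auto intro!: L2_fun_diff L2_fun_sum L2_fun_cmult f g)
  note integral_norm_add_squared_le[OF this]
  moreover have "f x + g x - (\<Sum>u\<in>T \<union> T'. d u * u x) = ?p x + ?q x" for x
    by (simp add: d)
  then have "(LINT x|M. (cmod (f x + g x - (\<Sum>u\<in>T \<union> T'. d u * u x)))\<^sup>2)
      = (LINT x|M. (cmod (?p x + ?q x))\<^sup>2)"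
    by (simp only:)
  ultimately have "(LINT x|M. (cmod (f x + g x - (\<Sum>u\<in>T \<union> T'. d u * u x)))\<^sup>2) < \<epsilon>"
    using T(3) T'(3) by linarith
  then show "\<exists>T c. finite T \<and> T \<subseteq> F \<and> (LINT x|M. (cmod (f x + g x - (\<Sum>g\<in>T. c g * g x)))\<^sup>2) < \<epsilon>"
    using T T' by (intro exI[of _ "T \<union> T'"] exI[of _ d]) auto
qed

lemma L2_approx_cmult:
  assumes "L2_approx M F f"
  shows "L2_approx M F (\<lambda>x. a * f x)"
  unfolding L2_approx_def
proof (intro allI impI)
  fix \<epsilon> :: real assume "0 < \<epsilon>"
  \<comment> \<open>The summand \<open>1\<close> keeps the denominator positive when
    \<open>a = 0\<close>.\<close>
  then have "0 < \<epsilon> / ((cmod a)\<^sup>2 + 1)" by (simp add: add_nonneg_pos)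
  then obtain T c where T: "finite T" "T \<subseteq> F"
      "(LINT x|M. (cmod (f x - (\<Sum>g\<in>T. c g * g x)))\<^sup>2) < \<epsilon> / ((cmod a)\<^sup>2 + 1)"
    using assms unfolding L2_approx_def by meson
  let ?I = "LINT x|M. (cmod (f x - (\<Sum>g\<in>T. c g * g x)))\<^sup>2"
  have "a * f x - (\<Sum>g\<in>T. (a * c g) * g x) = a * (f x - (\<Sum>g\<in>T. c g * g x))" for x
    by (simp add: right_diff_distrib sum_distrib_left mult.assoc)
  then have "(LINT x|M. (cmod (a * f x - (\<Sum>g\<in>T. (a * c g) * g x)))\<^sup>2) = (cmod a)\<^sup>2 * ?I"
    by (simp add: norm_mult power_mult_distrib)
  also have "\<dots> \<le> ((cmod a)\<^sup>2 + 1) * ?I" by (intro mult_right_mono) auto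
  also have "\<dots> < \<epsilon>"
    using T(3) by (simp add: pos_less_divide_eq add_nonneg_pos mult.commute)
  finally show "\<exists>T c. finite T \<and> T \<subseteq> F \<and> (LINT x|M. (cmod (a * f x - (\<Sum>g\<in>T. c g * g x)))\<^sup>2) < \<epsilon>"
    using T by (intro exI[of _ T] exI[of _ "\<lambda>g. a * c g"]) auto
qed

lemma L2_approx_closed:
  assumes F: "\<And>f. f \<in> F \<Longrightarrow> L2_fun M f" and f: "L2_fun M f"
    and ex: "\<And>\<epsilon>. 0 < \<epsilon> \<Longrightarrow>
      \<exists>g. L2_fun M g \<and> L2_approx M F g \<and> (LINT x|M. (cmod (f x - g x))\<^sup>2) < \<epsilon>"
  shows "L2_approx M F f"
  unfolding L2_approx_def
proof (intro allI impI)
  fix \<epsilon> :: real assume "0 < \<epsilon>"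
  then have "0 < \<epsilon> / 4" by simp
  then obtain g where g: "L2_fun M g" "L2_approx M F g" "(LINT x|M. (cmod (f x - g x))\<^sup>2) < \<epsilon> / 4"
    using ex by blast
  obtain T c where T: "finite T" "T \<subseteq> F" "(LINT x|M. (cmod (g x - (\<Sum>u\<in>T. c u * u x)))\<^sup>2) < \<epsilon> / 4"
    using g(2) \<open>0 < \<epsilon> / 4\<close> unfolding L2_approx_def by meson
  have "L2_fun M (\<lambda>x. f x - g x)" "L2_fun M (\<lambda>x. g x - (\<Sum>u\<in>T. c u * u x))"
    using T F by (auto intro!: L2_fun_diff L2_fun_sum L2_fun_cmult f g)
  from integral_norm_add_squared_le[OF this]
  have "(LINT x|M. (cmod (f x - (\<Sum>u\<in>T. c u * u x)))\<^sup>2) < \<epsilon>"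
    using T(3) g(3) by simp
  then show "\<exists>T c. finite T \<and> T \<subseteq> F \<and> (LINT x|M. (cmod (f x - (\<Sum>g\<in>T. c g * g x)))\<^sup>2) < \<epsilon>"
    using T by blast
qed

lemma (in finite_measure) L2_fun_bounded:
  assumes "f \<in> borel_measurable M" "\<And>x. cmod (f x) \<le> C"
  shows "L2_fun M f"
proof -
  have "(cmod (f x))\<^sup>2 \<le> C\<^sup>2" for x
    using assms(2) by (intro power_mono) auto
  then have "integrable M (\<lambda>x. (cmod (f x))\<^sup>2)"
    using assms(1) by (intro integrable_const_bound[of _ "C\<^sup>2"]) auto
  then show ?thesis using assms(1) by (simp add: L2_fun_def)
qed

text \<open>Dominated convergence of the squared errors makes the pointwise limit an L2 limit.
  Indicators of closed sets, countable disjoint unions and general functions are all reached this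
  way.\<close>

lemma (in finite_measure) L2_approx_limit:
  assumes F: "\<And>f. f \<in> F \<Longrightarrow> L2_fun M f" and f: "L2_fun M f"
    and s: "\<And>n. L2_fun M (s n)" "\<And>n. L2_approx M F (s n)"
    and lim: "\<And>x. x \<in> space M \<Longrightarrow> (\<lambda>n. s n x) \<longlonglongrightarrow> f x"
    and w: "integrable M w" "\<And>n x. x \<in> space M \<Longrightarrow> (cmod (f x - s n x))\<^sup>2 \<le> w x"
  shows "L2_approx M F f"
proof (rule L2_approx_closed[OF F f])
  fix \<epsilon> :: real assume "0 < \<epsilon>"
  have [measurable]: "f \<in> borel_measurable M" "\<And>n. s n \<in> borel_measurable M"
    using f s by (auto simp: L2_fun_def)
  have "(\<lambda>n. LINT x|M. (cmod (f x - s n x))\<^sup>2) \<longlonglongrightarrow> (LINT x|M. 0)"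
  proof (rule integral_dominated_convergence[where w = w])
    show "AE x in M. (\<lambda>n. (cmod (f x - s n x))\<^sup>2) \<longlonglongrightarrow> 0"
    proof (rule AE_I2)
      fix x assume "x \<in> space M"
      then have "(\<lambda>n. (cmod (f x - s n x))\<^sup>2) \<longlonglongrightarrow> (cmod (f x - f x))\<^sup>2"
        by (intro tendsto_intros lim)
      then show "(\<lambda>n. (cmod (f x - s n x))\<^sup>2) \<longlonglongrightarrow> 0" by simp
    qed
  qed (use w in auto)
  then have "\<forall>\<^sub>F n in sequentially. (LINT x|M. (cmod (f x - s n x))\<^sup>2) < \<epsilon>"
    using \<open>0 < \<epsilon>\<close> order_tendstoD(2)[of _ 0 sequentially \<epsilon>] by simp
  then obtain n where "(LINT x|M. (cmod (f x - s n x))\<^sup>2) < \<epsilon>"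
    by (meson eventually_sequentially le_refl)
  then show "\<exists>g. L2_fun M g \<and> L2_approx M F g \<and> (LINT x|M. (cmod (f x - g x))\<^sup>2) < \<epsilon>"
    using s by blast
qed

section \<open>Exponentials and trigonometric polynomials\<close>

lemma norm_expo [simp]: "cmod (expo t x) = 1"
  by (simp add: expo_def norm_exp_eq_Re)

lemma expo_add: "expo (s + t) x = expo s x * expo t x"
  by (simp add: expo_def inner_add_left distrib_left exp_add)

lemma expo_0 [simp]: "expo 0 x = 1"
  by (simp add: expo_def)

lemma cnj_expo: "cnj (expo t x) = expo (- t) x"
  by (simp add: expo_def exp_cnj)

lemma continuous_on_expo [continuous_intros]: "continuous_on A (expo t)"
  unfolding expo_def by (intro continuous_intros)

inductive trig_poly :: "(real^'n \<Rightarrow> complex) \<Rightarrow> bool" where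
  single: "trig_poly (\<lambda>x. c * expo t x)"
| add: "trig_poly p \<Longrightarrow> trig_poly q \<Longrightarrow> trig_poly (\<lambda>x. p x + q x)"

lemma trig_poly_const: "trig_poly (\<lambda>_. c)"
  using trig_poly.single[of c 0] by simp

lemma trig_poly_mult:
  assumes "trig_poly p" "trig_poly q"
  shows "trig_poly (\<lambda>x. p x * q x)"
  using assms(1)
proof (induction p)
  case (single c t)
  show ?case
    using assms(2)
  proof (induction q)
    case (single d s)
    then show ?case
      using trig_poly.single[of "c * d" "t + s"] by (simp add: expo_add mult_ac)
  next
    case (add p q)
    then show ?case using trig_poly.add by (simp add: distrib_left)
  qed
next
  case (add p q)
  then show ?case using trig_poly.add by (simp add: distrib_right)
qed

lemma continuous_on_trig_poly: "trig_poly p \<Longrightarrow> continuous_on A p"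
  by (induction rule: trig_poly.induct) (intro continuous_intros | assumption)+

text \<open>The frequency \<open>t\<close> has inner product \<open>1 / 2\<close> with
  \<open>x - y\<close>, so \<open>expo t\<close> takes opposite values at the two points. Its real
  or imaginary part separates them, and both are combinations of \<open>expo t\<close> and
  \<open>expo (- t)\<close>.\<close>

lemma trig_poly_separates:
  fixes x y :: "real^'n"
  assumes "x \<noteq> y"
  shows "\<exists>g :: real^'n \<Rightarrow> real. trig_poly (\<lambda>x. complex_of_real (g x)) \<and> g x \<noteq> g y"
proof -
  define t where "t = (1 / (2 * ((x - y) \<bullet> (x - y)))) *\<^sub>R (x - y)"
  have "t \<bullet> x = t \<bullet> y + 1 / 2"
    using assms inner_diff_right[of t x y] by (simp add: t_def)
  then have "expo t x = expo t y * exp (of_real pi * \<i>)"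
    by (simp add: expo_def distrib_left exp_add)
  then have "expo t x * cnj (expo t y) = - (expo t y * cnj (expo t y))" by simp
  then have "expo t x * cnj (expo t y) = -1"
    by (simp add: complex_norm_square[symmetric])
  moreover have "expo t x * cnj (expo t x) = 1"
    by (simp add: complex_norm_square[symmetric])
  ultimately have "expo t x \<noteq> expo t y" by force
  then consider "Re (expo t x) \<noteq> Re (expo t y)" | "Im (expo t x) \<noteq> Im (expo t y)"
    using complex_eqI by blast
  then show ?thesis
  proof cases
    case 1
    have "trig_poly (\<lambda>x. 1/2 * expo t x + 1/2 * expo (-t) x)"
      by (intro trig_poly.intros)
    moreover have "1/2 * expo t x + 1/2 * expo (-t) x = of_real (Re (expo t x))" for x
      by (simp add: cnj_expo[symmetric] complex_eq_iff)
    ultimately have "trig_poly (\<lambda>x. complex_of_real (Re (expo t x)))" by simp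
    then show ?thesis using 1 by (intro exI[of _ "\<lambda>x. Re (expo t x)"]) simp
  next
    case 2
    have "trig_poly (\<lambda>x. (-\<i>/2) * expo t x + (\<i>/2) * expo (-t) x)"
      by (intro trig_poly.intros)
    moreover have "(-\<i>/2) * expo t x + (\<i>/2) * expo (-t) x = of_real (Im (expo t x))" for x
      by (simp add: cnj_expo[symmetric] complex_eq_iff)
    ultimately have "trig_poly (\<lambda>x. complex_of_real (Im (expo t x)))" by simp
    then show ?thesis using 2 by (intro exI[of _ "\<lambda>x. Im (expo t x)"]) simp
  qed
qed

text \<open>Stone-Weierstrass on \<open>K\<close>, for the ring of real functions that become
  trigonometric polynomials when embedded into the complex numbers.\<close>

lemma trig_poly_uniform_approx:
  fixes f :: "real^'n \<Rightarrow> real"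
  assumes "compact K" "continuous_on K f" "0 < e"
  shows "\<exists>g. trig_poly (\<lambda>x. complex_of_real (g x)) \<and> (\<forall>x\<in>K. \<bar>f x - g x\<bar> < e)"
proof -
  interpret function_ring_on "{g :: real^'n \<Rightarrow> real. trig_poly (\<lambda>x. complex_of_real (g x))}" K
  proof
    fix f :: "real^'n \<Rightarrow> real"
    assume "f \<in> {g. trig_poly (\<lambda>x. complex_of_real (g x))}"
    then have "continuous_on K (\<lambda>x. Re (complex_of_real (f x)))"
      by (intro continuous_on_Re continuous_on_trig_poly) simp
    then show "continuous_on K f" by simp
  qed (use assms(1) trig_poly.add trig_poly_mult trig_poly_const trig_poly_separates in auto)
  show ?thesis
    using Stone_Weierstrass_basic[OF assms(2,3)] by auto
qed

section \<open>From exponentials to all square-integrable functions\<close>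

locale borel_compact_support = finite_measure M
  for M :: "(real^'n) measure" and K +
  assumes sets_borel: "sets M = sets borel"
    and compact: "compact K" and null: "measure M (- K) = 0"
begin

lemma space_UNIV: "space M = UNIV"
  using sets_eq_imp_space_eq[OF sets_borel] by simp

lemma borel_measurable_continuous: "continuous_on UNIV f \<Longrightarrow> f \<in> borel_measurable M"
  using borel_measurable_continuous_onI measurable_cong_sets[OF sets_borel refl] by blast

lemma AE_K: "AE x in M. x \<in> K"
proof -
  have "- K \<in> null_sets M"
    using null compact by (auto simp: null_sets_def emeasure_eq_measure sets_borel compact_imp_closed)
  then show ?thesis by (rule AE_I') auto
qed

lemma L2_fun_expo: "L2_fun M (expo t)"
  by (rule L2_fun_bounded[of _ 1]) (auto intro: borel_measurable_continuous continuous_on_expo)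

lemma L2_fun_trig_poly: "trig_poly p \<Longrightarrow> L2_fun M p"
  by (induction rule: trig_poly.induct) (auto intro: L2_fun_add L2_fun_cmult L2_fun_expo)

context
  fixes F
  assumes F: "\<And>f. f \<in> F \<Longrightarrow> L2_fun M f"
    and expo_approx: "\<And>t. L2_approx M F (expo t)"
begin

lemma L2_approx_trig_poly: "trig_poly p \<Longrightarrow> L2_approx M F p"
  by (induction rule: trig_poly.induct)
     (auto intro: L2_approx_cmult expo_approx L2_approx_add[OF F] L2_fun_trig_poly)

text \<open>Uniform approximation on the compact set \<open>K\<close> controls the L2 distance,
  because the complement of \<open>K\<close> is a null set.\<close>

lemma L2_approx_continuous:
  fixes f :: "real^'n \<Rightarrow> real"
  assumes f: "continuous_on UNIV f" "L2_fun M (\<lambda>x. complex_of_real (f x))"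
  shows "L2_approx M F (\<lambda>x. complex_of_real (f x))"
proof (rule L2_approx_closed[OF F f(2)])
  fix \<epsilon> :: real assume "0 < \<epsilon>"
  \<comment> \<open>Chosen so that \<open>e\<^sup>2\<close> times the total mass stays below
    \<open>\<epsilon>\<close>, also when the total mass is \<open>0\<close>.\<close>
  define e where "e = sqrt (\<epsilon> / (measure M (space M) + 1))"
  have "0 < e" using \<open>0 < \<epsilon>\<close> by (simp add: e_def add_nonneg_pos)
  then obtain g where g: "trig_poly (\<lambda>x. complex_of_real (g x))" "\<And>x. x \<in> K \<Longrightarrow> \<bar>f x - g x\<bar> < e"
    using trig_poly_uniform_approx[OF compact _ \<open>0 < e\<close>, of f] f(1) continuous_on_subset by blast
  have "integrable M (\<lambda>x. (cmod (complex_of_real (f x) - complex_of_real (g x)))\<^sup>2)"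
    using L2_fun_diff[OF f(2) L2_fun_trig_poly[OF g(1)]] by (simp add: L2_fun_def)
  then have "(LINT x|M. (cmod (complex_of_real (f x) - complex_of_real (g x)))\<^sup>2) \<le> (LINT x|M. e\<^sup>2)"
  proof (rule integral_mono_AE)
    show "AE x in M. (cmod (complex_of_real (f x) - complex_of_real (g x)))\<^sup>2 \<le> e\<^sup>2"
      using AE_K
    proof eventually_elim
      case (elim x)
      have "cmod (complex_of_real (f x) - complex_of_real (g x)) = \<bar>f x - g x\<bar>"
        by (metis norm_of_real of_real_diff)
      then show ?case using g(2)[OF elim] by (intro power_mono) auto
    qed
  qed simp
  also have "\<dots> = \<epsilon> * (measure M (space M) / (measure M (space M) + 1))"
    using \<open>0 < \<epsilon>\<close> by (simp add: e_def)
  also have "\<dots> < \<epsilon>"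
    using \<open>0 < \<epsilon>\<close> measure_nonneg[of M "space M"]
    by (simp add: pos_divide_less_eq add_nonneg_pos distrib_left)
  finally show "\<exists>h. L2_fun M h \<and> L2_approx M F h \<and> (LINT x|M. (cmod (complex_of_real (f x) - h x))\<^sup>2) < \<epsilon>"
    using g(1) L2_fun_trig_poly L2_approx_trig_poly by blast
qed

lemma L2_fun_indicator: "A \<in> sets borel \<Longrightarrow> L2_fun M (indicator A)"
  using sets_borel by (intro L2_fun_bounded[of _ 1]) (auto simp: indicator_def)

lemma L2_approx_closed_set:
  assumes "closed A"
  shows "L2_approx M F (indicator A)"
\<comment> \<open>The distance \<open>infdist x {}\<close> is \<open>0\<close> by convention, so the
  functions used below would converge to \<open>1\<close> for the empty set.\<close>
proof (cases "A = {}")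
  case True
  then have "indicator A = (\<lambda>_. 0 :: complex)" by auto
  then show ?thesis using L2_approx_trig_poly[OF trig_poly_const[of 0]] by simp
next
  case False
  \<comment> \<open>Continuous functions that decrease to the indicator of \<open>A\<close>: a point
    outside the closed set has positive distance, so its values are eventually cut off at
    \<open>0\<close>.\<close>
  define s where "s n x = max 0 (1 - real n * infdist x A)" for n x
  have s: "continuous_on UNIV (s n)" "0 \<le> s n x" "s n x \<le> 1" for n x
    unfolding s_def by (auto intro!: continuous_intros simp: infdist_nonneg)
  have L2: "L2_fun M (\<lambda>x. complex_of_real (s n x))" for n
    using s by (intro L2_fun_bounded[of _ 1] borel_measurable_continuous continuous_intros) auto
  show ?thesis
  proof (rule L2_approx_limit[OF F, where s = "\<lambda>n x. complex_of_real (s n x)" and w = "\<lambda>_. 1"])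
    show "L2_fun M (indicator A)" using assms by (intro L2_fun_indicator) auto
    show "L2_approx M F (\<lambda>x. complex_of_real (s n x))" for n
      using s L2 by (intro L2_approx_continuous) auto
    show "(\<lambda>n. complex_of_real (s n x)) \<longlonglongrightarrow> indicator A x" for x
    proof (cases "x \<in> A")
      case True
      then show ?thesis by (simp add: s_def)
    next
      case out: False
      then have pos: "0 < infdist x A"
        using assms False by (metis closure_closed in_closure_iff_infdist_zero infdist_nonneg less_eq_real_def)
      then obtain n0 where n0: "1 < real n0 * infdist x A"
        using reals_Archimedean3 by blast
      have "s n x = 0" if "n0 \<le> n" for n
      proof -
        have "real n0 * infdist x A \<le> real n * infdist x A"
          using that pos by (intro mult_right_mono) auto
        then show ?thesis using n0 by (simp add: s_def)
      qed
      then have "\<forall>\<^sub>F n in sequentially. complex_of_real (s n x) = 0"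
        using eventually_sequentiallyI[of n0] by auto
      then show ?thesis using out tendsto_eventually by fastforce
    qed
    show "(cmod (indicator A x - complex_of_real (s n x)))\<^sup>2 \<le> 1" for n x
    proof -
      have "(indicator A x :: complex) = of_real (indicator A x)" by (simp add: indicator_def)
      then have "cmod (indicator A x - complex_of_real (s n x)) = \<bar>indicator A x - s n x\<bar>"
        by (metis norm_of_real of_real_diff)
      also have "\<dots> \<le> 1" using s(2,3)[of n x] by (auto simp: indicator_def)
      finally show ?thesis by (simp add: power_le_one)
    qed
  qed (use L2 in auto)
qed

text \<open>Dynkin's argument: closed sets form an intersection-stable generator, and the sets with
  approximable indicator are stable under complements and countable disjoint unions.\<close>

lemma L2_approx_indicator:
  assumes "A \<in> sets borel"
  shows "L2_approx M F (indicator A)"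
proof -
  have borel: "sets borel = sigma_sets UNIV (Collect (closed :: (real^'n) set \<Rightarrow> bool))"
    by (simp add: borel_eq_closed)
  have "Int_stable (Collect (closed :: (real^'n) set \<Rightarrow> bool))" by (auto simp: Int_stable_def)
  moreover have "Collect closed \<subseteq> Pow (UNIV :: (real^'n) set)" by simp
  ultimately show ?thesis
    using assms unfolding borel
  proof (induction rule: sigma_sets_induct_disjoint)
    case (basic A)
    then show ?case by (simp add: L2_approx_closed_set)
  next
    case empty
    show ?case by (rule L2_approx_closed_set) simp
  next
    case (compl A)
    have "A \<in> sets borel" using compl(1) by (simp add: borel)
    then have "L2_approx M F (\<lambda>x. 1 + (-1) * indicator A x)"
      by (intro L2_approx_add[OF F] L2_fun_trig_poly L2_approx_trig_poly trig_poly_const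
          L2_fun_cmult[of _ _ "-1"] L2_approx_cmult[of _ _ _ "-1"] L2_fun_indicator compl(2))
    moreover have "(\<lambda>x. 1 + (-1) * indicator A x) = (indicator (UNIV - A) :: _ \<Rightarrow> complex)"
      by (auto simp: indicator_def)
    ultimately show ?case by simp
  next
    case (union A)
    have A: "A i \<in> sets borel" for i using union(2) by (auto simp: borel)
    have ind: "(\<Sum>i<n. indicator (A i) x) = (indicator (\<Union>i<n. A i) x :: complex)" for n x
      by (rule indicator_UN_disjoint[symmetric]) (use union(1) in \<open>auto simp: disjoint_family_on_def\<close>)
    show ?case
    proof (rule L2_approx_limit[OF F, where s = "\<lambda>n x. \<Sum>i<n. indicator (A i) x" and w = "\<lambda>_. 1"])
      show "L2_fun M (indicator (\<Union> (range A)))" using A by (intro L2_fun_indicator) auto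
      show L2: "L2_fun M (\<lambda>x. \<Sum>i<n. indicator (A i) x)" for n
        using A by (intro L2_fun_sum L2_fun_indicator)
      show "L2_approx M F (\<lambda>x. \<Sum>i<n. indicator (A i) x)" for n
      proof (induction n)
        case 0
        show ?case using L2_approx_trig_poly[OF trig_poly_const[of 0]] by simp
      next
        case (Suc n)
        show ?case
          unfolding sum.lessThan_Suc
          using Suc union(3) A by (intro L2_approx_add[OF F] L2_fun_indicator L2_fun_sum)
      qed
      show "(\<lambda>n. \<Sum>i<n. indicator (A i) x) \<longlonglongrightarrow> (indicator (\<Union> (range A)) x :: complex)" for x
        unfolding ind using LIMSEQ_indicator_UN[of A x] by (simp add: lessThan_atLeast0)
      show "(cmod (indicator (\<Union> (range A)) x - (\<Sum>i<n. indicator (A i) x)))\<^sup>2 \<le> 1" for n x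
        unfolding ind by (auto simp: indicator_def)
    qed auto
  qed
qed

text \<open>A measurable \<open>f\<close> is a pointwise limit of simple functions of modulus at
  most \<open>2 * cmod (f x)\<close>, so the integrable function
  \<open>(3 * cmod (f x))\<^sup>2\<close> dominates the squared errors.\<close>

lemma L2_approx_all:
  assumes "L2_fun M f"
  shows "L2_approx M F f"
proof -
  have "f \<in> borel_measurable M" using assms by (simp add: L2_fun_def)
  from borel_measurable_implies_sequence_metric[OF this, of 0]
  obtain s where simple: "\<And>i. simple_function M (s i)"
    and lim: "\<And>x. (\<lambda>i. s i x) \<longlonglongrightarrow> f x"
    and bound: "\<And>i x. cmod (s i x) \<le> 2 * cmod (f x)"
    by (auto simp: space_UNIV)
  have scaleR: "indicator A x *\<^sub>R y = y * indicator A x" for A and x :: "real^'n" and y :: complex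
    by (simp add: indicator_def)
  have rep: "s i = (\<lambda>x. \<Sum>y\<in>s i ` space M. y * indicator (s i -` {y}) x)" for i
    unfolding space_UNIV
    by (rule ext) (rule simple_function_indicator_representation_banach
        [OF simple, unfolded space_UNIV scaleR Int_UNIV_right, OF UNIV_I])
  have fin: "finite (s i ` space M)" and sets: "s i -` {y} \<in> sets borel" for i y
    using simple[of i] simple_functionD(2)[OF simple[of i], of "{y}"]
    by (auto simp: simple_function_def space_UNIV sets_borel)
  have L2: "L2_fun M (s i)" for i
    by (subst rep) (intro L2_fun_sum L2_fun_cmult L2_fun_indicator sets)
  have sum: "L2_approx M F (\<lambda>x. \<Sum>y\<in>Y. y * indicator (s i -` {y}) x)" if "finite Y" for Y i
    using that
  proof (induction Y)
    case empty
    show ?case using L2_approx_trig_poly[OF trig_poly_const[of 0]] by simp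
  next
    case (insert y Y)
    have "L2_approx M F (\<lambda>x. y * indicator (s i -` {y}) x + (\<Sum>y\<in>Y. y * indicator (s i -` {y}) x))"
      using insert by (intro L2_approx_add[OF F] L2_fun_sum L2_fun_cmult L2_fun_indicator sets
          L2_approx_cmult L2_approx_indicator)
    then show ?case by (simp only: sum.insert[OF insert(1,2)])
  qed
  show ?thesis
  proof (rule L2_approx_limit[OF F assms L2])
    show "L2_approx M F (s i)" for i
      by (subst rep) (rule sum[OF fin])
    show "(\<lambda>i. s i x) \<longlonglongrightarrow> f x" for x by (rule lim)
    show "integrable M (\<lambda>x. (3 * cmod (f x))\<^sup>2)"
      using assms by (simp add: L2_fun_def power_mult_distrib)
    show "(cmod (f x - s n x))\<^sup>2 \<le> (3 * cmod (f x))\<^sup>2" for n x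
      using norm_triangle_ineq4[of "f x" "s n x"] bound[of n x] by (intro power_mono) auto
  qed
qed

end

end

section \<open>Masks and the Fourier transform of the invariant measure\<close>

text \<open>The extreme value theorem for lower semicontinuous functions: the sublevel sets slightly
  above the infimum are nested, compact and nonempty, and a common point of them is a minimum
  point.\<close>

lemma attains_min_closed_sublevels:
  fixes h :: "'a::heine_borel \<Rightarrow> real"
  assumes X: "compact X" "X \<noteq> {}" and closed: "\<And>c. closed {x. h x \<le> c}"
    and bdd: "bdd_below (h ` X)"
  obtains x where "x \<in> X" "\<And>y. y \<in> X \<Longrightarrow> h x \<le> h y"
proof -
  define m where "m = Inf (h ` X)"
  define Y where "Y n = X \<inter> {x. h x \<le> m + 1 / real (Suc n)}" for n
  have "\<Inter> (range Y) \<noteq> {}"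
  proof (rule compact_nest)
    show "compact (Y n)" for n
      unfolding Y_def using X(1) closed by (rule compact_Int_closed)
    show "Y n \<noteq> {}" for n
    proof -
      have "Inf (h ` X) < m + 1 / real (Suc n)" by (simp add: m_def)
      then obtain x where "x \<in> X" "h x < m + 1 / real (Suc n)"
        using cInf_lessD[of "h ` X"] X(2) by auto
      then show ?thesis by (auto simp: Y_def intro: less_imp_le)
    qed
    show "Y n \<subseteq> Y k" if "k \<le> n" for k n
    proof -
      have "1 / real (Suc n) \<le> 1 / real (Suc k)" using that by (intro divide_left_mono) auto
      then show ?thesis by (auto simp: Y_def)
    qed
  qed
  then obtain x where x: "\<And>n. x \<in> Y n" by blast
  have "h x \<le> h y" if "y \<in> X" for y
  proof (rule field_le_epsilon)
    fix e :: real assume "0 < e"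
    then obtain n where "1 / real (Suc n) < e" using nat_approx_posE by blast
    moreover have "h x \<le> m + 1 / real (Suc n)" using x[of n] by (simp add: Y_def)
    moreover have "m \<le> h y" unfolding m_def using that bdd by (intro cInf_lower) auto
    ultimately show "h x \<le> h y + e" by linarith
  qed
  then show ?thesis using that x[of 0] by (auto simp: Y_def)
qed

lemma expo_inner_Ints:
  assumes "t \<bullet> x \<in> \<int>"
  shows "expo t x = 1"
proof -
  obtain k :: int where "t \<bullet> x = of_int k" using assms by (auto simp: Ints_def)
  then show ?thesis unfolding expo_def exp_eq_1 by auto
qed

lemma expo_eq_1_Ints:
  assumes "expo t x = 1"
  shows "t \<bullet> x \<in> \<int>"
proof -
  obtain k :: int where "2 * pi * (t \<bullet> x) = of_int (2 * k) * pi"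
    using assms unfolding expo_def exp_eq_1 by auto
  then have "t \<bullet> x = of_int k" by simp
  then show ?thesis by simp
qed

lemma expo_commute: "expo s t = expo t s"
  by (simp add: expo_def inner_commute)

lemma expo_add_right: "expo t (x + y) = expo t x * expo t y"
  by (simp add: expo_def inner_add_right distrib_left exp_add)

definition mask :: "(real^'n) set \<Rightarrow> real^'n \<Rightarrow> complex" where
  "mask B x = (1 / of_nat (card B)) * (\<Sum>b\<in>B. expo b x)"

lemma W_eq_mask: "W B x = (cmod (mask B x))\<^sup>2"
  by (simp add: W_def mask_def)

lemma mask_add_Ints:
  assumes "\<And>b. b \<in> B \<Longrightarrow> b \<bullet> v \<in> \<int>"
  shows "mask B (v + z) = mask B z"
  by (simp add: mask_def expo_add_right expo_inner_Ints assms)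

lemma mask_0: "finite B \<Longrightarrow> B \<noteq> {} \<Longrightarrow> mask B 0 = 1"
  by (simp add: mask_def expo_inner_Ints)

text \<open>The triangle inequality for \<open>\<Sum>b\<in>B. expo b x\<close> can only be sharp if every summand equals
  the summand \<open>1\<close> of \<open>b = 0\<close>.\<close>

lemma W_eq_1_imp_Ints:
  assumes "finite B" "0 \<in> B" "W B x = 1" "b \<in> B"
  shows "b \<bullet> x \<in> \<int>"
proof (cases "b = 0")
  case False
  let ?e = "expo b x" and ?r = "\<Sum>b\<in>B - {0, b}. expo b x"
  have N: "card B > 0" using assms card_gt_0_iff by blast
  have "card (B - {0, b}) + 2 = card B"
    using assms False N card_mono[of B "{0, b}"] by (subst card_Diff_subset) auto
  then have N2: "real (card (B - {0, b})) = real (card B) - 2" by linarith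
  have "B = insert 0 (insert b (B - {0, b}))" using assms by auto
  then have split: "(\<Sum>b\<in>B. expo b x) = 1 + (?e + ?r)"
    using assms(1) False by (metis (no_types, lifting) Diff_iff expo_0 finite.insertI finite_Diff insert_iff sum.insert)
  have "cmod (\<Sum>b\<in>B. expo b x) = card B"
    using assms(3) N by (simp add: W_def norm_mult norm_divide power2_eq_1_iff)
      (use norm_ge_zero[of "\<Sum>b\<in>B. expo b x"] in \<open>auto simp: field_simps\<close>)
  moreover have "cmod (1 + (?e + ?r)) \<le> cmod (1 + ?e) + cmod ?r"
    using norm_triangle_ineq[of "1 + ?e" ?r] by (simp add: add.assoc)
  moreover have "cmod ?r \<le> card (B - {0, b})"
    using norm_sum[of "\<lambda>b. expo b x" "B - {0, b}"] by simp
  ultimately have "2 \<le> cmod (1 + ?e)" using N2 unfolding split by linarith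
  then have "2\<^sup>2 \<le> (cmod (1 + ?e))\<^sup>2" by (rule power_mono) simp
  moreover have unit: "(Re ?e)\<^sup>2 + (Im ?e)\<^sup>2 = 1"
    using cmod_power2[of ?e] by simp
  ultimately have "Re ?e \<ge> 1" by (simp add: cmod_power2 power2_sum)
  moreover note unit
  moreover have "(Re ?e)\<^sup>2 \<ge> 1" using \<open>Re ?e \<ge> 1\<close> by (simp add: one_le_power)
  ultimately have "Im ?e = 0" "Re ?e = 1"
    using complex_Re_le_cmod[of ?e] by (auto simp: order_antisym)
  then have "?e = 1" by (simp add: complex_eq_iff)
  then show ?thesis by (rule expo_eq_1_Ints)
qed simp

lemma continuous_on_tau [continuous_intros]: "continuous_on A (tau M v)"
  unfolding tau_def
  by (rule continuous_on_compose2[OF matrix_vector_mult_linear_continuous_on[of UNIV]])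
     (auto intro!: continuous_intros)

text \<open>Invariance is given for sets. It passes to simple functions through their level sets,
  and to bounded measurable functions by dominated convergence with a constant bound.\<close>

lemma integral_invariant_measure:
  fixes f :: "real^'n \<Rightarrow> complex"
  assumes inv: "invariant_measure R B M"
    and f: "f \<in> borel_measurable borel" "\<And>x. cmod (f x) \<le> C"
  shows "(LINT x|M. f x) = 1 / of_nat (card B) * (\<Sum>b\<in>B. LINT x|M. f (tau R b x))"
proof -
  interpret prob_space M using inv by (simp add: invariant_measure_def)
  have sets: "sets M = sets borel" using inv by (simp add: invariant_measure_def)
  then have space: "space M = UNIV" using sets_eq_imp_space_eq by fastforce
  have tau[measurable]: "tau R b \<in> M \<rightarrow>\<^sub>M borel" for b
    using borel_measurable_continuous_onI[OF continuous_on_tau] measurable_cong_sets[OF sets refl] by blast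
  have f_M[measurable]: "f \<in> borel_measurable M"
    using f(1) measurable_cong_sets[OF sets refl] by blast
  obtain s where simple: "\<And>i. simple_function borel (s i)"
    and lim: "\<And>x. (\<lambda>i. s i x) \<longlonglongrightarrow> f x"
    and bound: "\<And>i x. cmod (s i x) \<le> 2 * cmod (f x)"
    using borel_measurable_implies_sequence_metric[OF f(1), of 0] by auto
  have s_borel[measurable]: "s i \<in> borel_measurable borel" for i
    using simple by (rule borel_measurable_simple_function)
  then have s_M[measurable]: "s i \<in> borel_measurable M" for i
    using measurable_cong_sets[OF sets refl] by blast
  have bound': "cmod (s i x) \<le> 2 * C" for i x using bound[of i x] f(2)[of x] by linarith
  have fin: "finite (range (s i))" and level: "s i -` {y} \<in> sets borel" for i y
    using simple[of i] simple_functionD(2)[OF simple[of i], of "{y}"]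
    by (auto simp: simple_function_def)
  have rep: "s i x = (\<Sum>y\<in>range (s i). y * indicator (s i -` {y}) x)" for i x
  proof -
    have "(\<Sum>y\<in>range (s i). y * indicator (s i -` {y}) x) = (\<Sum>y\<in>range (s i). if y = s i x then s i x else 0)"
      by (intro sum.cong) (auto simp: indicator_def)
    then show ?thesis using fin by simp
  qed
  \<comment> \<open>The map \<open>g\<close> will be both the identity and each
    \<open>tau R b\<close>, so both sides of the identity are covered at once.\<close>
  have integral_level: "(LINT x|M. s i (g x)) = (\<Sum>y\<in>range (s i). y * measure M (g -` (s i -` {y})))"
    if [measurable]: "g \<in> M \<rightarrow>\<^sub>M borel" for g :: "real^'n \<Rightarrow> real^'n" and i
  proof -
    have pre: "g -` (s i -` {y}) \<in> sets M" for y
      using measurable_sets[OF that level[of i y]] by (simp add: space)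
    have ind: "indicator (s i -` {y}) (g x) = (indicator (g -` (s i -` {y})) x :: complex)" for x y
      by (simp add: indicator_def)
    have int: "integrable M (\<lambda>x. y * indicator (g -` (s i -` {y})) x :: complex)" for y
      by (rule integrable_const_bound[of _ "cmod y"])
         (auto simp: indicator_def
           intro!: borel_measurable_times borel_measurable_const borel_measurable_indicator pre)
    have "(LINT x|M. s i (g x)) = (LINT x|M. (\<Sum>y\<in>range (s i). y * indicator (g -` (s i -` {y})) x))"
      by (intro Bochner_Integration.integral_cong refl) (subst rep, simp only: ind)
    also have "\<dots> = (\<Sum>y\<in>range (s i). LINT x|M. y * indicator (g -` (s i -` {y})) x)"
      by (intro Bochner_Integration.integral_sum int)
    also have "\<dots> = (\<Sum>y\<in>range (s i). y * measure M (g -` (s i -` {y})))"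
    proof (intro sum.cong refl)
      fix y
      let ?A = "g -` (s i -` {y})"
      have "(LINT x|M. indicator ?A x :: complex) = of_real (LINT x|M. indicator ?A x)"
        unfolding integral_complex_of_real[symmetric] by (simp add: of_real_indicator)
      then show "(LINT x|M. y * indicator ?A x) = y * of_real (measure M ?A)"
        using pre[of y] by (simp add: space)
    qed
    finally show ?thesis .
  qed
  have ident: "(\<lambda>x. x) \<in> M \<rightarrow>\<^sub>M borel"
    by (rule measurable_ident_sets[OF sets])
  have eq: "(LINT x|M. s i x) = 1 / of_nat (card B) * (\<Sum>b\<in>B. LINT x|M. s i (tau R b x))" for i
  proof -
    have "(LINT x|M. s i x) = (\<Sum>y\<in>range (s i). y * measure M (s i -` {y}))"
      using integral_level[OF ident] by (simp only: vimage_ident)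
    also have "\<dots> = (\<Sum>y\<in>range (s i). y * of_real ((1 / real (card B)) * (\<Sum>b\<in>B. measure M (tau R b -` (s i -` {y})))))"
      using inv level[of i] by (intro sum.cong refl arg_cong2[of _ _ _ _ "(*)"] arg_cong[of _ _ complex_of_real])
        (auto simp: invariant_measure_def)
    also have "\<dots> = 1 / of_nat (card B) * (\<Sum>b\<in>B. \<Sum>y\<in>range (s i). y * measure M (tau R b -` (s i -` {y})))"
      by (subst sum.swap) (simp add: sum_distrib_left sum_distrib_right mult_ac)
    also have "\<dots> = 1 / of_nat (card B) * (\<Sum>b\<in>B. LINT x|M. s i (tau R b x))"
      by (simp only: integral_level[OF tau])
    finally show ?thesis .
  qed
  have conv: "(\<lambda>i. LINT x|M. s i (g x)) \<longlonglongrightarrow> (LINT x|M. f (g x))"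
    if [measurable]: "g \<in> M \<rightarrow>\<^sub>M borel" for g :: "real^'n \<Rightarrow> real^'n"
  proof (rule integral_dominated_convergence[where w = "\<lambda>_. 2 * C"])
    show "(\<lambda>x. f (g x)) \<in> borel_measurable M" using measurable_compose[OF that f(1)] .
  qed (use lim bound' in auto)
  have "(\<lambda>i. 1 / of_nat (card B) * (\<Sum>b\<in>B. LINT x|M. s i (tau R b x)))
      \<longlonglongrightarrow> 1 / of_nat (card B) * (\<Sum>b\<in>B. LINT x|M. f (tau R b x))"
    by (intro tendsto_intros conv tau)
  moreover have "(\<lambda>i. LINT x|M. s i x) \<longlonglongrightarrow> (LINT x|M. f x)"
    by (rule conv[OF ident])
  ultimately show ?thesis
    unfolding eq by (rule LIMSEQ_unique[rotated])
qed

definition fourier :: "(real^'n) measure \<Rightarrow> real^'n \<Rightarrow> complex" where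
  "fourier M y = (LINT x|M. expo y x)"

lemma fourier_minus: "fourier M (- y) = cnj (fourier M y)"
  by (simp add: fourier_def cnj_expo[symmetric])

lemma shift_funpow: "(shift ^^ n) \<omega> = (\<lambda>k. \<omega> (n + k))"
  by (induction n arbitrary: \<omega>) (auto simp: shift_def)

lemma shift_funpow_add: "(shift ^^ m) ((shift ^^ n) \<omega>) = (shift ^^ (m + n)) \<omega>"
  by (simp add: funpow_add)

lemma Omega_shift_funpow: "\<omega> \<in> Omega L \<Longrightarrow> (shift ^^ n) \<omega> \<in> Omega L"
  by (simp add: Omega_def shift_funpow)

section \<open>Hadamard pairs, transition probabilities and the refinement equation\<close>

locale hadamard_ifs =
  fixes R S :: "real^'n^'n" and B L X :: "(real^'n) set" and \<mu> :: "(real^'n) measure"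
  assumes expanding: "\<And>z. complex_eigenvalue R z \<Longrightarrow> cmod z > 1"
    and S: "S = transpose R"
    and finite: "finite B" "finite L"
    and card: "card B = card L"
    and unitary: "unitary_on B L
          (\<lambda>b l. 1 / complex_of_real (sqrt (real (card B))) * expo (matrix_inv R *v b) l)"
    and integral: "\<And>b l n. b \<in> B \<Longrightarrow> l \<in> L \<Longrightarrow> (((*v) R ^^ n) b) \<bullet> l \<in> \<int>"
    and zero: "0 \<in> B" "0 \<in> L"
    and mu: "invariant_measure R B \<mu>"
    and X: "attractor S L X"
begin

abbreviation Si :: "real^'n \<Rightarrow> real^'n" where "Si x \<equiv> matrix_inv S *v x"

lemma invertible_R: "invertible R"
  by (rule invertible_of_expanding) (rule expanding)

lemma S_Si [simp]: "S *v Si x = x" and Si_S [simp]: "Si (S *v x) = x"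
  using transpose_invertible[OF invertible_R]
  by (simp_all add: S matrix_vector_mul_assoc matrix_inv_mult_right matrix_inv_mult_left
      del: transpose_matrix_vector)

lemma Si_iterates: "(\<lambda>n. ((*v) (matrix_inv S) ^^ n) x) \<longlonglongrightarrow> 0"
  unfolding S by (rule transpose_inverse_iterates_tendsto_0) (rule expanding)

lemma inner_R: "(R *v b) \<bullet> x = b \<bullet> (S *v x)"
  using dot_lmul_matrix[of x R b] by (simp add: S inner_commute)

lemma inner_matrix_inv_R: "(matrix_inv R *v b) \<bullet> x = b \<bullet> Si x"
proof -
  have "R *v (matrix_inv R *v b) = b"
    by (simp add: matrix_vector_mul_assoc matrix_inv_mult_right invertible_R)
  then show ?thesis using inner_R[of "matrix_inv R *v b" "Si x"] by simp
qed

lemma expo_matrix_inv_R: "expo (matrix_inv R *v b) x = expo b (Si x)"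
  by (simp add: expo_def inner_matrix_inv_R)

lemma tau_S: "tau S l x = Si x + Si l"
  by (simp add: tau_def matrix_vector_right_distrib)

lemma S_tau: "S *v tau S l x = x + l"
  by (simp add: tau_def)

lemma card_pos: "card B > 0"
  using finite zero card_gt_0_iff by blast

lemma sqrt_card: "complex_of_real (sqrt (real (card B))) * complex_of_real (sqrt (real (card B))) = of_nat (card B)"
  by (simp flip: of_real_mult)

text \<open>This is the orthogonality of the columns \<open>l\<close> and \<open>l'\<close> of the
  unitary matrix, after moving the inverse of \<open>R\<close> from \<open>b\<close> to the
  digits.\<close>

lemma mask_digit_zero:
  assumes "l \<in> L" "l' \<in> L" "l \<noteq> l'"
  shows "mask B (Si (l - l')) = 0"
proof -
  have "0 = (\<Sum>b\<in>B. cnj (1 / complex_of_real (sqrt (real (card B))) * expo (matrix_inv R *v b) l')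
      * (1 / complex_of_real (sqrt (real (card B))) * expo (matrix_inv R *v b) l))"
    using unitary assms unfolding unitary_on_def by auto
  also have "\<dots> = (\<Sum>b\<in>B. 1 / of_nat (card B) * expo b (Si (l - l')))"
  proof (intro sum.cong refl)
    fix b
    have "cnj (expo b (Si l')) * expo b (Si l) = expo b (Si (l - l'))"
      using expo_add_right[of b "Si l" "- Si l'"] cnj_expo[of "Si l'" b]
      by (simp add: matrix_vector_mult_diff_distrib mult.commute expo_commute)
    then show "cnj (1 / complex_of_real (sqrt (real (card B))) * expo (matrix_inv R *v b) l')
        * (1 / complex_of_real (sqrt (real (card B))) * expo (matrix_inv R *v b) l)
        = 1 / of_nat (card B) * expo b (Si (l - l'))"
      by (simp add: expo_matrix_inv_R sqrt_card mult_ac)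
  qed
  also have "\<dots> = mask B (Si (l - l'))" by (simp add: mask_def sum_distrib_left)
  finally show ?thesis by simp
qed

text \<open>Expanding the squared modulus gives a double sum over \<open>b\<close> and
  \<open>b'\<close>; summed over \<open>l\<close>, orthonormality of the rows leaves the diagonal.
  So the values \<open>W B (tau S l x)\<close> are transition probabilities.\<close>

lemma sum_W_tau: "(\<Sum>l\<in>L. W B (tau S l x)) = 1"
proof -
  define N :: complex where "N = of_nat (card B)"
  have N: "N \<noteq> 0" using card_pos by (simp add: N_def)
  define U where "U b l = 1 / complex_of_real (sqrt (real (card B))) * expo (matrix_inv R *v b) l" for b l
  have U: "(\<Sum>l\<in>L. U b l * cnj (U b' l)) = (if b = b' then 1 else 0)" if "b \<in> B" "b' \<in> B" for b b'
    using unitary that unfolding unitary_on_def U_def by blast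
  have e: "expo b (Si l) * cnj (expo b' (Si l)) = N * (U b l * cnj (U b' l))" for b b' l
    using N by (simp add: U_def N_def expo_matrix_inv_R sqrt_card[symmetric])
  have "complex_of_real (W B (tau S l x)) = 1 / N * (\<Sum>b\<in>B. \<Sum>b'\<in>B.
      1 / N * (expo b (Si x) * cnj (expo b' (Si x))) * (expo b (Si l) * cnj (expo b' (Si l))))" for l
    unfolding W_eq_mask complex_norm_square
    by (simp add: mask_def tau_S expo_add_right N_def sum_product sum_distrib_left mult_ac)
       (rule sum.swap)
  then have "complex_of_real (\<Sum>l\<in>L. W B (tau S l x)) = (\<Sum>l\<in>L. 1 / N * (\<Sum>b\<in>B. \<Sum>b'\<in>B.
      (expo b (Si x) * cnj (expo b' (Si x))) * (U b l * cnj (U b' l))))"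
    using N by (simp add: e) (simp add: mult_ac)
  also have "\<dots> = 1 / N * (\<Sum>b\<in>B. \<Sum>b'\<in>B. \<Sum>l\<in>L.
      (expo b (Si x) * cnj (expo b' (Si x))) * (U b l * cnj (U b' l)))"
    by (simp only: sum_distrib_left[symmetric] sum.swap[of _ _ L])
  also have "\<dots> = 1 / N * (\<Sum>b\<in>B. \<Sum>b'\<in>B.
      (expo b (Si x) * cnj (expo b' (Si x))) * (if b = b' then 1 else 0))"
    by (intro arg_cong2[of _ _ _ _ "(*)"] refl sum.cong) (simp add: sum_distrib_left[symmetric] U)
  also have "\<dots> = 1 / N * (\<Sum>b\<in>B. expo b (Si x) * cnj (expo b (Si x)))"
    using finite by (simp add: if_distrib cong: if_cong)
  also have "\<dots> = 1"
    using N by (simp add: complex_norm_square[symmetric] N_def)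
  finally show ?thesis by (metis of_real_eq_1_iff)
qed

sublocale prob_space \<mu>
  using mu by (simp add: invariant_measure_def)

lemma sets_mu: "sets \<mu> = sets borel"
  using mu by (simp add: invariant_measure_def)

lemma expo_measurable [measurable]: "expo y \<in> borel_measurable \<mu>"
  using borel_measurable_continuous_onI[OF continuous_on_expo] measurable_cong_sets[OF sets_mu refl] by blast

lemma integrable_expo: "integrable \<mu> (expo y)"
  by (rule integrable_const_bound[of _ 1]) auto

lemma fourier_0: "fourier \<mu> 0 = 1"
  by (simp add: fourier_def prob_space)

lemma continuous_on_fourier: "continuous_on A (fourier \<mu>)"
proof (rule continuous_at_imp_continuous_on, rule ballI)
  fix y
  show "isCont (fourier \<mu>) y"
    unfolding continuous_at_sequentially
  proof (intro allI impI)
    fix u :: "nat \<Rightarrow> real^'n" assume "u \<longlonglongrightarrow> y"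
    then have "(\<lambda>n. expo (u n) x) \<longlonglongrightarrow> expo y x" for x
      unfolding expo_def by (intro tendsto_intros)
    then show "(fourier \<mu> \<circ> u) \<longlonglongrightarrow> fourier \<mu> y"
      unfolding fourier_def comp_def
      by (intro integral_dominated_convergence[where w = "\<lambda>_. 1"]) auto
  qed
qed

text \<open>Since \<open>y \<bullet> tau R b x = Si y \<bullet> (x + b)\<close>, each term of the
  invariance identity for \<open>expo y\<close> splits into a factor depending on \<open>b\<close>
  and the Fourier integrand at \<open>Si y\<close>.\<close>

lemma fourier_refinement: "fourier \<mu> y = mask B (Si y) * fourier \<mu> (Si y)"
proof -
  have "expo y (tau R b x) = expo b (Si y) * expo (Si y) x" for b x
  proof -
    have "y \<bullet> tau R b x = Si y \<bullet> (x + b)"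
      using inner_matrix_inv_R[of "x + b" y] by (simp add: tau_def inner_commute)
    then have "expo y (tau R b x) = expo (Si y) (x + b)" by (simp add: expo_def)
    then show ?thesis by (simp add: expo_add_right expo_commute[of "Si y" b])
  qed
  moreover have "fourier \<mu> y = 1 / of_nat (card B) * (\<Sum>b\<in>B. LINT x|\<mu>. expo y (tau R b x))"
    unfolding fourier_def
    by (rule integral_invariant_measure[OF mu, of _ 1])
       (auto intro: borel_measurable_continuous_onI continuous_on_expo)
  ultimately show ?thesis
    by (simp add: fourier_def mask_def sum_distrib_right)
qed

text \<open>Integrality makes the mask blind to \<open>v\<close>, so the refinement equation leaves
  the factor \<open>mask B (Si (l - l'))\<close>, which vanishes for distinct digits and is
  \<open>1\<close> for equal ones.\<close>

lemma fourier_step: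
  assumes "\<And>b. b \<in> B \<Longrightarrow> b \<bullet> v \<in> \<int>" "l \<in> L" "l' \<in> L"
  shows "fourier \<mu> (S *v v + (l - l')) = (if l = l' then fourier \<mu> v else 0)"
proof -
  have "Si (S *v v + (l - l')) = v + Si (l - l')" by (simp add: matrix_vector_right_distrib)
  then have "fourier \<mu> (S *v v + (l - l')) = mask B (Si (l - l')) * fourier \<mu> (v + Si (l - l'))"
    using fourier_refinement[of "S *v v + (l - l')"] mask_add_Ints[OF assms(1)] by simp
  then show ?thesis
    using assms mask_digit_zero[of l l'] mask_0[OF finite(1)] zero(1) by auto
qed

section \<open>Attractor and coding map\<close>

text \<open>All digit maps have the same linear part, so the effect of a composition on differences
  depends only on its length.\<close>

lemma foldr_tau_diff:
  "foldr (tau S) ls x - foldr (tau S) ls y = ((*v) (matrix_inv S) ^^ length ls) (x - y)"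
  by (induction ls) (auto simp: tau_S matrix_vector_mult_diff_distrib[symmetric])

lemma foldr_tau_replicate_0: "foldr (tau S) (replicate n 0) x = ((*v) (matrix_inv S) ^^ n) x"
  by (induction n) (auto simp: tau_S)

lemma X_nonempty: "X \<noteq> {}" and compact_X: "compact X"
  using X by (auto simp: attractor_def)

lemma tau_X: "x \<in> X \<Longrightarrow> l \<in> L \<Longrightarrow> tau S l x \<in> X"
  using X unfolding attractor_def by blast

lemma foldr_tau_X: "x \<in> X \<Longrightarrow> set ls \<subseteq> L \<Longrightarrow> foldr (tau S) ls x \<in> X"
  by (induction ls) (auto intro: tau_X)

text \<open>The map \<open>tau S 0\<close> fixes \<open>0\<close> and its iterates send any point of
  the closed invariant set \<open>X\<close> towards \<open>0\<close>.\<close>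

lemma zero_in_X: "0 \<in> X"
proof -
  obtain x where "x \<in> X" using X_nonempty by blast
  then have "foldr (tau S) (replicate n 0) x \<in> X" for n
    using zero by (intro foldr_tau_X) auto
  then have "((*v) (matrix_inv S) ^^ n) x \<in> X" for n
    unfolding foldr_tau_replicate_0 .
  then show ?thesis
    using closed_sequentially[OF compact_imp_closed[OF compact_X] _ Si_iterates] by blast
qed

text \<open>A single digit map may expand the norm, so there is no contraction constant to rely on.
  Decay on the finitely many basis vectors gives a rate that is uniform on the bounded set
  \<open>X\<close>.\<close>

lemma Si_iterates_uniform_on_X:
  assumes "0 < e"
  shows "\<exists>n0. \<forall>n\<ge>n0. \<forall>x\<in>X. norm (((*v) (matrix_inv S) ^^ n) x) < e"
proof -
  obtain C where C: "\<And>x. x \<in> X \<Longrightarrow> norm x \<le> C"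
    using compact_imp_bounded[OF compact_X] bounded_iff by blast
  define g where "g n = (\<Sum>i\<in>UNIV. C * norm (((*v) (matrix_inv S) ^^ n) (axis i 1)))" for n
  have lin: "linear ((*v) (matrix_inv S) ^^ n)" for n
  proof (induction n)
    case (Suc n)
    then show ?case using linear_compose[OF Suc matrix_vector_mul_linear, of "matrix_inv S"] by (simp add: o_def)
  qed (simp add: linear_id[unfolded id_def] id_def)
  have le: "norm (((*v) (matrix_inv S) ^^ n) x) \<le> g n" if "x \<in> X" for n x
  proof -
    let ?T = "(*v) (matrix_inv S) ^^ n"
    have "?T x = ?T (\<Sum>i\<in>UNIV. (x $ i) *\<^sub>R axis i 1)"
      using basis_expansion[of x] by (simp add: scalar_mult_eq_scaleR)
    also have "\<dots> = (\<Sum>i\<in>UNIV. (x $ i) *\<^sub>R ?T (axis i 1))"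
      using lin[of n] by (simp add: linear_sum linear_cmul)
    finally have "norm (?T x) \<le> (\<Sum>i\<in>UNIV. \<bar>x $ i\<bar> * norm (?T (axis i 1)))"
      by (metis (no_types, lifting) norm_scaleR norm_sum sum.cong)
    also have "\<dots> \<le> g n"
      unfolding g_def using C[OF that] component_le_norm_cart[of x]
      by (intro sum_mono mult_right_mono) (auto intro: order_trans)
    finally show ?thesis .
  qed
  have "g \<longlonglongrightarrow> (\<Sum>i\<in>(UNIV::'n set). C * norm (0 :: real^'n))"
    unfolding g_def by (intro tendsto_intros Si_iterates)
  then have "\<forall>\<^sub>F n in sequentially. g n < e"
    using order_tendstoD(2) assms by fastforce
  then show ?thesis
    using le unfolding eventually_sequentially by (meson le_less_trans)
qed

text \<open>Gives meaning to the \<open>lim\<close> in the coding map. The digits after position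
  \<open>n0\<close> applied to \<open>0\<close> give a point of \<open>X\<close>, so later terms
  differ from term \<open>n0\<close> by the \<open>n0\<close>-th iterate of a point of
  \<open>X\<close>.\<close>

lemma coding_LIMSEQ:
  assumes "\<omega> \<in> Omega L"
  shows "(\<lambda>n. foldr (tau S) (map \<omega> [0..<n]) 0) \<longlonglongrightarrow> coding S \<omega>"
proof -
  let ?a = "\<lambda>n. foldr (tau S) (map \<omega> [0..<n]) 0"
  have digits: "set (map \<omega> [m..<n]) \<subseteq> L" for m n
    using assms by (auto simp: Omega_def)
  have "Cauchy ?a"
  proof (rule metric_CauchyI)
    fix e :: real assume "0 < e"
    then obtain n0 where n0: "\<And>x n. n \<ge> n0 \<Longrightarrow> x \<in> X \<Longrightarrow> norm (((*v) (matrix_inv S) ^^ n) x) < e / 2"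
      using Si_iterates_uniform_on_X[of "e / 2"] by auto
    have close: "dist (?a m) (?a n0) < e / 2" if "n0 \<le> m" for m
    proof -
      have "[0..<m] = [0..<n0] @ [n0..<m]" using that by (metis le_add_diff_inverse upt_add_eq_append zero_le)
      then have "?a m = foldr (tau S) (map \<omega> [0..<n0]) (foldr (tau S) (map \<omega> [n0..<m]) 0)" by simp
      then have "?a m - ?a n0 = ((*v) (matrix_inv S) ^^ n0) (foldr (tau S) (map \<omega> [n0..<m]) 0)"
        by (simp add: foldr_tau_diff)
      then show ?thesis
        using n0[OF order_refl foldr_tau_X[OF zero_in_X digits]] by (simp add: dist_norm)
    qed
    show "\<exists>M. \<forall>m\<ge>M. \<forall>n\<ge>M. dist (?a m) (?a n) < e"
      using close dist_triangle_half_l by (intro exI[of _ n0]) blast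
  qed
  then show ?thesis
    unfolding coding_def by (simp add: Cauchy_convergent_iff convergent_LIMSEQ_iff)
qed

lemma coding_shift:
  assumes "\<omega> \<in> Omega L"
  shows "tau S (\<omega> 0) (coding S (shift \<omega>)) = coding S \<omega>"
proof -
  have "shift \<omega> \<in> Omega L" using assms by (simp add: Omega_def shift_def)
  then have "(\<lambda>n. tau S (\<omega> 0) (foldr (tau S) (map (shift \<omega>) [0..<n]) 0))
      \<longlonglongrightarrow> tau S (\<omega> 0) (coding S (shift \<omega>))"
    using continuous_on_tendsto_compose[OF continuous_on_tau coding_LIMSEQ, of _ UNIV] by simp
  moreover have "tau S (\<omega> 0) (foldr (tau S) (map (shift \<omega>) [0..<n]) 0)
      = foldr (tau S) (map \<omega> [0..<Suc n]) 0" for n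
    by (simp add: map_upt_Suc shift_def del: upt_Suc)
  ultimately show ?thesis
    using LIMSEQ_unique LIMSEQ_Suc[OF coding_LIMSEQ[OF assms]] by simp
qed

lemma coding_funpow_step:
  assumes "\<omega> \<in> Omega L"
  shows "tau S (\<omega> n) (coding S ((shift ^^ Suc n) \<omega>)) = coding S ((shift ^^ n) \<omega>)"
  using coding_shift[OF Omega_shift_funpow[OF assms, of n]] by (simp add: shift_funpow)

lemma S_coding:
  assumes "\<omega> \<in> Omega L"
  shows "S *v coding S ((shift ^^ n) \<omega>) = coding S ((shift ^^ Suc n) \<omega>) + \<omega> n"
  using coding_funpow_step[OF assms, of n] S_tau by metis

section \<open>Periodic words and orthogonality\<close>

lemma mask_B_0: "mask B 0 = 1"
  using finite(1) zero(1) by (intro mask_0) auto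

text \<open>Describes a point of a \<open>W\<close>-cycle by its word instead of by the set of
  points, so that the digit leading to the next point is at hand.\<close>

definition W_periodic :: "(nat \<Rightarrow> real^'n) \<Rightarrow> bool" where
  "W_periodic \<omega> \<longleftrightarrow> \<omega> \<in> Omega L \<and> (\<exists>p\<ge>1. (shift ^^ p) \<omega> = \<omega>) \<and>
     (\<forall>n. W B (coding S ((shift ^^ n) \<omega>)) = 1)"

lemma W_cycle_imp_W_periodic:
  assumes "W_cycle B S L C" "x \<in> C"
  shows "\<exists>\<omega>. W_periodic \<omega> \<and> x = coding S \<omega>"
proof -
  obtain \<omega> p where \<omega>: "\<omega> \<in> Omega L" "p \<ge> 1" "(shift ^^ p) \<omega> = \<omega>"
    and C: "C = coding S ` {(shift ^^ k) \<omega> | k. k < p}"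
    using assms unfolding W_cycle_def is_cycle_def by blast
  obtain j where j: "x = coding S ((shift ^^ j) \<omega>)" using assms(2) C by blast
  have "W B (coding S ((shift ^^ n) \<omega>)) = 1" for n
  proof -
    have "(shift ^^ n) \<omega> = (shift ^^ (n mod p)) \<omega>" using funpow_mod_eq[OF \<omega>(3)] by simp
    moreover have "n mod p < p" using \<omega>(2) by simp
    ultimately have "coding S ((shift ^^ n) \<omega>) \<in> C" unfolding C by auto
    then show ?thesis using assms(1) by (simp add: W_cycle_def)
  qed
  then have "W B (coding S ((shift ^^ n) ((shift ^^ j) \<omega>))) = 1" for n
    by (simp add: shift_funpow_add)
  moreover have "(shift ^^ p) ((shift ^^ j) \<omega>) = (shift ^^ j) \<omega>"
    by (metis shift_funpow_add add.commute \<omega>(3))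
  ultimately have "W_periodic ((shift ^^ j) \<omega>)"
    using \<omega> Omega_shift_funpow unfolding W_periodic_def by blast
  then show ?thesis using j by blast
qed

lemma W_periodic_imp_W_cycle:
  assumes "W_periodic \<omega>"
  shows "\<exists>C. W_cycle B S L C \<and> coding S \<omega> \<in> C"
proof -
  obtain p where p: "\<omega> \<in> Omega L" "p \<ge> 1" "(shift ^^ p) \<omega> = \<omega>"
    using assms by (auto simp: W_periodic_def)
  let ?C = "coding S ` {(shift ^^ k) \<omega> | k. k < p}"
  have "W_cycle B S L ?C"
    unfolding W_cycle_def is_cycle_def using p assms by (auto simp: W_periodic_def)
  moreover have "coding S \<omega> \<in> ?C" using p(2) by (force intro: exI[of _ 0])
  ultimately show ?thesis by blast
qed

lemma W_periodic_shift: "W_periodic \<omega> \<Longrightarrow> W_periodic ((shift ^^ n) \<omega>)"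
proof -
  assume \<omega>: "W_periodic \<omega>"
  then obtain p where p: "p \<ge> 1" "(shift ^^ p) \<omega> = \<omega>" by (auto simp: W_periodic_def)
  have "(shift ^^ p) ((shift ^^ n) \<omega>) = (shift ^^ n) \<omega>"
    by (metis shift_funpow_add add.commute p(2))
  then show ?thesis
    using \<omega> p(1) by (auto simp: W_periodic_def Omega_shift_funpow shift_funpow_add)
qed

text \<open>On a word of period \<open>p\<close>, the power \<open>p - 1\<close> of the shift
  inverts the shift.\<close>

lemma W_periodic_unshift:
  assumes "W_periodic \<eta>"
  shows "\<exists>\<omega>. W_periodic \<omega> \<and> shift \<omega> = \<eta>"
proof -
  obtain p where p: "p \<ge> 1" "(shift ^^ p) \<eta> = \<eta>"
    using assms by (auto simp: W_periodic_def)
  then have "shift ((shift ^^ (p - 1)) \<eta>) = \<eta>" by (cases p) auto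
  then show ?thesis using W_periodic_shift[OF assms] by blast
qed

lemma W_periodic_zero: "W_periodic (\<lambda>_. 0)" and coding_zero: "coding S (\<lambda>_. 0) = 0"
proof -
  have sh: "(shift ^^ n) (\<lambda>_. 0 :: real^'n) = (\<lambda>_. 0)" for n by (simp add: shift_funpow)
  have om: "(\<lambda>_. 0) \<in> Omega L" using zero by (simp add: Omega_def)
  have "((*v) (matrix_inv S) ^^ n) 0 = 0" for n by (induction n) auto
  then have "foldr (tau S) (map (\<lambda>_. 0) [0..<n]) 0 = 0" for n
    using foldr_tau_replicate_0[of n 0] by (simp add: map_replicate_const)
  then show 0: "coding S (\<lambda>_. 0) = 0"
    using LIMSEQ_unique[OF coding_LIMSEQ[OF om]] by auto
  have "W B 0 = 1" by (simp add: W_eq_mask mask_B_0)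
  then show "W_periodic (\<lambda>_. 0)"
    unfolding W_periodic_def sh 0 using om by blast
qed

text \<open>The value \<open>1\<close> of \<open>W\<close> gives the case \<open>n = 0\<close>.
  Moving one factor \<open>R\<close> across the inner product replaces the point by its successor on
  the cycle plus a digit, and integrality on digits is a hypothesis.\<close>

lemma W_periodic_inner_Ints:
  assumes "W_periodic \<omega>" "b \<in> B"
  shows "((*v) R ^^ n) b \<bullet> coding S \<omega> \<in> \<int>"
  using assms(1)
proof (induction n arbitrary: \<omega>)
  case 0
  then have "W B (coding S ((shift ^^ 0) \<omega>)) = 1" unfolding W_periodic_def by blast
  then show ?case using W_eq_1_imp_Ints[OF finite(1) zero(1) _ assms(2)] by simp
next
  case (Suc n)
  have om: "\<omega> \<in> Omega L" using Suc.prems by (simp add: W_periodic_def)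
  then have "((*v) R ^^ Suc n) b \<bullet> coding S \<omega>
      = ((*v) R ^^ n) b \<bullet> coding S ((shift ^^ Suc 0) \<omega>) + ((*v) R ^^ n) b \<bullet> \<omega> 0"
    using S_coding[OF om, of 0] by (simp add: inner_R inner_add_right)
  moreover have "\<omega> 0 \<in> L" using om by (simp add: Omega_def)
  ultimately show ?case
    using Suc.IH[OF W_periodic_shift[OF Suc.prems, of "Suc 0"]] integral[OF assms(2)] by simp
qed

section \<open>The spectrum and orthogonality of its exponentials\<close>

abbreviation \<Lambda> where "\<Lambda> \<equiv> spectrum_set B S L"

lemma Lambda_W_periodic: "W_periodic \<omega> \<Longrightarrow> - coding S \<omega> \<in> \<Lambda>"
  using W_periodic_imp_W_cycle unfolding spectrum_set_def by blast

lemma Lambda_step: "t \<in> \<Lambda> \<Longrightarrow> l \<in> L \<Longrightarrow> S *v t + l \<in> \<Lambda>"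
  unfolding spectrum_set_def by blast

text \<open>The induction rule that comes with a least set: the intersection lies in each of its
  members.\<close>

lemma Lambda_subset:
  assumes "\<And>\<omega>. W_periodic \<omega> \<Longrightarrow> - coding S \<omega> \<in> Q"
    and "\<And>t l. t \<in> Q \<Longrightarrow> l \<in> L \<Longrightarrow> S *v t + l \<in> Q"
  shows "\<Lambda> \<subseteq> Q"
proof -
  have "uminus ` C \<subseteq> Q" if "W_cycle B S L C" for C
    using W_cycle_imp_W_periodic[OF that] assms(1) by blast
  then show ?thesis using assms(2) unfolding spectrum_set_def by blast
qed

lemma zero_in_Lambda: "0 \<in> \<Lambda>"
  using Lambda_W_periodic[OF W_periodic_zero] by (simp add: coding_zero)

lemma Lambda_inner_Ints:
  assumes "t \<in> \<Lambda>" "b \<in> B"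
  shows "b \<bullet> t \<in> \<int>"
proof -
  \<comment> \<open>All powers of \<open>R\<close> are needed for the induction, since pairing
    \<open>S *v t\<close> with one power is pairing \<open>t\<close> with the next.\<close>
  have "\<Lambda> \<subseteq> {t. \<forall>n. ((*v) R ^^ n) b \<bullet> t \<in> \<int>}"
  proof (rule Lambda_subset)
    show "- coding S \<omega> \<in> {t. \<forall>n. ((*v) R ^^ n) b \<bullet> t \<in> \<int>}" if "W_periodic \<omega>" for \<omega>
      using W_periodic_inner_Ints[OF that assms(2)] by simp
    fix t l assume t: "t \<in> {t. \<forall>n. ((*v) R ^^ n) b \<bullet> t \<in> \<int>}" and l: "l \<in> L"
    have "((*v) R ^^ n) b \<bullet> (S *v t + l) \<in> \<int>" for n
    proof -
      have "((*v) R ^^ n) b \<bullet> (S *v t) = ((*v) R ^^ Suc n) b \<bullet> t" by (simp add: inner_R)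
      then show ?thesis using t integral[OF assms(2) l, of n] by (simp add: inner_add_right del: funpow.simps)
    qed
    then show "S *v t + l \<in> {t. \<forall>n. ((*v) R ^^ n) b \<bullet> t \<in> \<int>}" by blast
  qed
  then have "((*v) R ^^ 0) b \<bullet> t \<in> \<int>" using assms(1) by blast
  then show ?thesis by simp
qed

lemma fourier_Lambda_step:
  assumes "t \<in> \<Lambda>" "t' \<in> \<Lambda>" "l \<in> L" "l' \<in> L"
  shows "fourier \<mu> ((S *v t + l) - (S *v t' + l')) = (if l = l' then fourier \<mu> (t - t') else 0)"
proof -
  have "(S *v t + l) - (S *v t' + l') = S *v (t - t') + (l - l')"
    by (simp add: matrix_vector_mult_diff_distrib)
  then show ?thesis
    using assms Lambda_inner_Ints by (simp only: fourier_step inner_diff_right Ints_diff)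
qed

text \<open>A nonzero transform of the difference at one index forces equal digits one index earlier
  and is inherited there. Descending through a common period of both words compares all their
  digits.\<close>

lemma fourier_W_periodic:
  assumes \<omega>: "W_periodic \<omega>" and \<eta>: "W_periodic \<eta>"
    and nz: "fourier \<mu> (- coding S \<omega> - - coding S \<eta>) \<noteq> 0"
  shows "\<omega> = \<eta>"
proof -
  have om: "\<omega> \<in> Omega L" "\<eta> \<in> Omega L" using \<omega> \<eta> by (auto simp: W_periodic_def)
  obtain p q where p: "p \<ge> 1" "(shift ^^ p) \<omega> = \<omega>" and q: "q \<ge> 1" "(shift ^^ q) \<eta> = \<eta>"
    using \<omega> \<eta> by (auto simp: W_periodic_def)
  define P where "P = p * q"
  have P: "(shift ^^ P) \<omega> = \<omega>" "(shift ^^ P) \<eta> = \<eta>" "P > 0"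
  proof -
    have "P mod p = 0" "P mod q = 0" by (auto simp: P_def)
    then show "(shift ^^ P) \<omega> = \<omega>" "(shift ^^ P) \<eta> = \<eta>"
      using funpow_mod_eq[OF p(2), of P] funpow_mod_eq[OF q(2), of P] by auto
    show "P > 0" using p q by (simp add: P_def)
  qed
  define t where "t n = - coding S ((shift ^^ n) \<omega>)" for n
  define u where "u n = - coding S ((shift ^^ n) \<eta>)" for n
  have t: "t n \<in> \<Lambda>" "t (Suc n) = S *v t n + \<omega> n" and u: "u n \<in> \<Lambda>" "u (Suc n) = S *v u n + \<eta> n" for n
    using Lambda_W_periodic[OF W_periodic_shift] \<omega> \<eta> S_coding[OF om(1), of n] S_coding[OF om(2), of n]
    unfolding t_def u_def by (auto simp: vec.neg[symmetric] matrix_vector_mult_minus)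
  have descend: "\<omega> n = \<eta> n \<and> fourier \<mu> (t n - u n) \<noteq> 0" if "fourier \<mu> (t (Suc n) - u (Suc n)) \<noteq> 0" for n
  proof -
    have "\<omega> n \<in> L" "\<eta> n \<in> L" using om by (auto simp: Omega_def)
    then show ?thesis
      using that fourier_Lambda_step[OF t(1) u(1), of "\<omega> n" "\<eta> n" n n] unfolding t(2) u(2)
      by (auto split: if_splits)
  qed
  have nz': "fourier \<mu> (t n - u n) \<noteq> 0" if "n \<le> P" for n
    using that
  proof (induction rule: inc_induct)
    case base
    \<comment> \<open>Index \<open>P\<close> is index \<open>0\<close> again, so the hypothesis at
      index \<open>0\<close> starts the descent at the top.\<close>
    show ?case using nz by (simp add: t_def u_def P)
  next
    case (step n)
    then show ?case using descend by blast
  qed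
  show ?thesis
  proof
    fix k
    have "k mod P < P" using P by simp
    then have "\<omega> (k mod P) = \<eta> (k mod P)" using descend nz' by simp
    then have "(shift ^^ (k mod P)) \<omega> 0 = (shift ^^ (k mod P)) \<eta> 0" by (simp add: shift_funpow)
    then have "(shift ^^ k) \<omega> 0 = (shift ^^ k) \<eta> 0"
      by (simp add: funpow_mod_eq[OF P(1)] funpow_mod_eq[OF P(2)])
    then show "\<omega> k = \<eta> k" by (simp add: shift_funpow)
  qed
qed

text \<open>Stratifies \<open>\<Lambda>\<close> by the number of digits appended to a negated cycle
  point. The levels increase, because a negated cycle point also arises from another one by a digit;
  hence two elements always share a level.\<close>

primrec level :: "nat \<Rightarrow> (real^'n) set" where
  "level 0 = {- coding S \<omega> | \<omega>. W_periodic \<omega>}"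
| "level (Suc n) = {S *v t + l | t l. t \<in> level n \<and> l \<in> L}"

lemma level_subset_Lambda: "level n \<subseteq> \<Lambda>"
  by (induction n) (auto intro: Lambda_W_periodic Lambda_step)

lemma level_mono_Suc: "level n \<subseteq> level (Suc n)"
proof (induction n)
  case 0
  show ?case
  proof
    fix x assume "x \<in> level 0"
    then obtain \<eta> where \<eta>: "x = - coding S \<eta>" "W_periodic \<eta>" by auto
    then obtain \<omega> where \<omega>: "W_periodic \<omega>" "shift \<omega> = \<eta>" using W_periodic_unshift by blast
    then have om: "\<omega> \<in> Omega L" by (simp add: W_periodic_def)
    have "x = S *v (- coding S \<omega>) + \<omega> 0"
      using S_coding[OF om, of 0] \<eta> \<omega> by (simp add: matrix_vector_mult_minus)
    moreover have "\<omega> 0 \<in> L" using om by (simp add: Omega_def)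
    ultimately show "x \<in> level (Suc 0)" using \<omega> by auto
  qed
next
  case (Suc n)
  then show ?case by auto blast
qed

lemma Lambda_eq_levels: "\<Lambda> = (\<Union>n. level n)"
proof
  show "\<Lambda> \<subseteq> (\<Union>n. level n)"
  proof (rule Lambda_subset)
    show "- coding S \<omega> \<in> (\<Union>n. level n)" if "W_periodic \<omega>" for \<omega>
      using that by (intro UN_I[of 0]) auto
    show "S *v t + l \<in> (\<Union>n. level n)" if t: "t \<in> (\<Union>n. level n)" and l: "l \<in> L" for t l
    proof -
      obtain n where "t \<in> level n" using t by blast
      then have "S *v t + l \<in> level (Suc n)" using l by auto
      then show ?thesis by blast
    qed
  qed
qed (use level_subset_Lambda in blast)

text \<open>Within a common level the same number of digits can be stripped from both points, and
  what remains are two negated cycle points.\<close>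

lemma fourier_Lambda_diff:
  assumes "s \<in> \<Lambda>" "t \<in> \<Lambda>"
  shows "fourier \<mu> (s - t) = (if s = t then 1 else 0)"
proof -
  have mono: "level m \<subseteq> level n" if "m \<le> n" for m n
    using lift_Suc_mono_le[of level, OF level_mono_Suc that] .
  obtain m n where "s \<in> level m" "t \<in> level n" using assms unfolding Lambda_eq_levels by blast
  then have st: "s \<in> level (max m n)" "t \<in> level (max m n)"
    using mono[of m "max m n"] mono[of n "max m n"] by auto
  have "s = t" if "fourier \<mu> (s - t) \<noteq> 0" "s \<in> level k" "t \<in> level k" for s t k
    using that
  proof (induction k arbitrary: s t)
    case 0
    then obtain \<omega> \<eta> where "W_periodic \<omega>" "s = - coding S \<omega>" "W_periodic \<eta>" "t = - coding S \<eta>"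
      by auto
    then show ?case using fourier_W_periodic[of \<omega> \<eta>] 0(1) by simp
  next
    case (Suc k)
    then obtain s' l t' l' where s: "s = S *v s' + l" "s' \<in> level k" "l \<in> L"
      and t: "t = S *v t' + l'" "t' \<in> level k" "l' \<in> L" by auto
    have "fourier \<mu> (s - t) = (if l = l' then fourier \<mu> (s' - t') else 0)"
      unfolding s t using s t level_subset_Lambda by (intro fourier_Lambda_step) auto
    then have "l = l'" "fourier \<mu> (s' - t') \<noteq> 0" using Suc.prems(1) by (auto split: if_splits)
    then show ?case using Suc.IH s t by blast
  qed
  then show ?thesis using st fourier_0 by auto
qed

text \<open>Lets the sums over \<open>t\<close> and \<open>l\<close> in the superharmonicity
  estimate be reindexed as a sum over points of \<open>\<Lambda>\<close>. Orthogonality is what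
  rules out two representations with different digits.\<close>

lemma inj_on_Lambda_L: "inj_on (\<lambda>(t, l). S *v t + l) (\<Lambda> \<times> L)"
proof (rule inj_onI, clarify)
  fix t l t' l' assume mem: "t \<in> \<Lambda>" "l \<in> L" "t' \<in> \<Lambda>" "l' \<in> L" and eq: "S *v t + l = S *v t' + l'"
  have "fourier \<mu> ((S *v t + l) - (S *v t' + l')) = 1" using eq fourier_0 by simp
  then have "l = l'" using fourier_Lambda_step[OF mem(1,3,2,4)] by (auto split: if_splits)
  moreover from this have "t = t'" using eq by (metis Si_S add_right_cancel)
  ultimately show "t = t' \<and> l = l'" by simp
qed

section \<open>The energy function\<close>

definition partial_energy :: "(real^'n) set \<Rightarrow> real^'n \<Rightarrow> real" where
  "partial_energy F x = (\<Sum>t\<in>F. (cmod (fourier \<mu> (x + t)))\<^sup>2)"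

text \<open>As a supremum of continuous finite sums, the energy has closed sublevel sets without any
  discussion of convergence of series.\<close>

definition energy :: "real^'n \<Rightarrow> real" where
  "energy x = (SUP F\<in>{F. finite F \<and> F \<subseteq> \<Lambda>}. partial_energy F x)"

text \<open>The squared distance of \<open>expo y\<close> from its orthogonal projection onto the
  span of \<open>F\<close>. Its nonnegativity is Bessel's inequality, and its smallness will be
  completeness. The sign in \<open>- y\<close> comes from the energy being a sum over
  \<open>x + t\<close>.\<close>

lemma norm_integral_expo_minus_projection:
  assumes F: "finite F" "F \<subseteq> \<Lambda>"
  shows "(LINT x|\<mu>. (cmod (expo y x - (\<Sum>t\<in>F. fourier \<mu> (y - t) * expo t x)))\<^sup>2)
    = 1 - partial_energy F (- y)"
proof -
  define c where "c t = fourier \<mu> (y - t)" for t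
  have e: "expo s x * cnj (expo t x) = expo (s - t) x" for s t x
    using expo_add[of s "- t" x] by (simp add: cnj_expo)
  have pe: "complex_of_real (partial_energy F (- y)) = (\<Sum>t\<in>F. c t * cnj (c t))"
  proof -
    have "cmod (fourier \<mu> (- y + t)) = cmod (c t)" for t
      using fourier_minus[of \<mu> "y - t"] by (simp add: c_def)
    then show ?thesis by (simp only: partial_energy_def of_real_sum complex_norm_square)
  qed
  \<comment> \<open>The constant term stays in the form \<open>expo 0 x\<close>, so that every term
    integrates to a value of \<open>fourier \<mu>\<close>.\<close>
  have "complex_of_real ((cmod (expo y x - (\<Sum>t\<in>F. c t * expo t x)))\<^sup>2)
    = expo 0 x - (\<Sum>t\<in>F. cnj (c t) * expo (y - t) x) - (\<Sum>t\<in>F. c t * expo (t - y) x)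
      + (\<Sum>t\<in>F. \<Sum>s\<in>F. c t * cnj (c s) * expo (t - s) x)" for x
  proof -
    have "complex_of_real ((cmod (expo y x - (\<Sum>t\<in>F. c t * expo t x)))\<^sup>2)
      = expo y x * cnj (expo y x) - (\<Sum>t\<in>F. cnj (c t) * (expo y x * cnj (expo t x)))
        - (\<Sum>t\<in>F. c t * (expo t x * cnj (expo y x)))
        + (\<Sum>t\<in>F. \<Sum>s\<in>F. c t * cnj (c s) * (expo t x * cnj (expo s x)))"
      unfolding complex_norm_square
      by (simp add: algebra_simps sum_product sum_distrib_left) (rule sum.swap)
    then show ?thesis by (simp only: e diff_self)
  qed
  then have "complex_of_real (LINT x|\<mu>. (cmod (expo y x - (\<Sum>t\<in>F. c t * expo t x)))\<^sup>2)
    = (LINT x|\<mu>. expo 0 x - (\<Sum>t\<in>F. cnj (c t) * expo (y - t) x) - (\<Sum>t\<in>F. c t * expo (t - y) x)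
      + (\<Sum>t\<in>F. \<Sum>s\<in>F. c t * cnj (c s) * expo (t - s) x))"
    by (simp only: integral_complex_of_real[symmetric])
  also have "\<dots> = fourier \<mu> 0 - (\<Sum>t\<in>F. cnj (c t) * fourier \<mu> (y - t)) - (\<Sum>t\<in>F. c t * fourier \<mu> (t - y))
      + (\<Sum>t\<in>F. \<Sum>s\<in>F. c t * cnj (c s) * fourier \<mu> (t - s))"
    unfolding fourier_def
    by (simp add: integrable_expo Bochner_Integration.integral_sum
        del: expo_0)
  also have "\<dots> = 1 - (\<Sum>t\<in>F. cnj (c t) * c t) - (\<Sum>t\<in>F. c t * cnj (c t))
      + (\<Sum>t\<in>F. \<Sum>s\<in>F. if t = s then c t * cnj (c s) else 0)"
  proof -
    have "fourier \<mu> (t - y) = cnj (c t)" for t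
      using fourier_minus[of \<mu> "y - t"] by (simp add: c_def)
    moreover have "(\<Sum>t\<in>F. \<Sum>s\<in>F. c t * cnj (c s) * fourier \<mu> (t - s))
        = (\<Sum>t\<in>F. \<Sum>s\<in>F. if t = s then c t * cnj (c s) else 0)"
      using F(2) by (intro sum.cong refl) (auto simp: fourier_Lambda_diff subset_iff)
    ultimately show ?thesis by (simp add: fourier_0 c_def[symmetric])
  qed
  also have "\<dots> = complex_of_real (1 - partial_energy F (- y))"
    using F(1) by (simp add: pe mult.commute)
  finally show ?thesis by (simp only: of_real_eq_iff c_def)
qed

lemma partial_energy_le_1: "finite F \<Longrightarrow> F \<subseteq> \<Lambda> \<Longrightarrow> partial_energy F x \<le> 1"
  using norm_integral_expo_minus_projection[of F "- x"]
    Bochner_Integration.integral_nonneg[of \<mu> "\<lambda>z. (cmod (expo (- x) z - (\<Sum>t\<in>F. fourier \<mu> (- x - t) * expo t z)))\<^sup>2"]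
  by simp

lemma partial_energy_mono: "finite G \<Longrightarrow> F \<subseteq> G \<Longrightarrow> partial_energy F x \<le> partial_energy G x"
  unfolding partial_energy_def by (intro sum_mono2) auto

lemma bdd_above_partial_energy: "bdd_above ((\<lambda>F. partial_energy F x) ` {F. finite F \<and> F \<subseteq> \<Lambda>})"
  using partial_energy_le_1 by (intro bdd_aboveI2[of _ _ 1]) auto

lemma partial_energy_le_energy: "finite F \<Longrightarrow> F \<subseteq> \<Lambda> \<Longrightarrow> partial_energy F x \<le> energy x"
  unfolding energy_def by (rule cSUP_upper[OF _ bdd_above_partial_energy]) simp

lemma energy_approx:
  assumes "c < energy x"
  obtains F where "finite F" "F \<subseteq> \<Lambda>" "c < partial_energy F x"
  using assms less_cSUP_iff[OF _ bdd_above_partial_energy, of c x]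
  unfolding energy_def by auto

lemma energy_nonneg: "0 \<le> energy x"
  using partial_energy_le_energy[of "{}" x] by (simp add: partial_energy_def)

lemma continuous_on_partial_energy: "continuous_on UNIV (partial_energy F)"
  unfolding partial_energy_def
  by (intro continuous_intros continuous_on_compose2[OF continuous_on_fourier[of UNIV]]) auto

lemma closed_energy_sublevel: "closed {x. energy x \<le> c}"
proof -
  have "{x. energy x \<le> c} = (\<Inter>F\<in>{F. finite F \<and> F \<subseteq> \<Lambda>}. {x. partial_energy F x \<le> c})"
    unfolding energy_def using cSUP_le_iff[OF _ bdd_above_partial_energy] by auto
  moreover have "closed {x. partial_energy F x \<le> c}" for F
    by (intro closed_Collect_le continuous_on_partial_energy continuous_on_const)
  ultimately show ?thesis by auto
qed

lemma energy_ge_1_at_minus_Lambda: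
  assumes "- x \<in> \<Lambda>"
  shows "1 \<le> energy x"
  using partial_energy_le_energy[of "{- x}" x] assms by (simp add: partial_energy_def fourier_0)

text \<open>By the refinement equation, weighting the term of \<open>t\<close> at
  \<open>tau S l x\<close> by its transition probability gives the term of \<open>S *v t + l\<close>
  at \<open>x\<close>. These points of \<open>\<Lambda>\<close> are distinct, so the left side is at
  most the energy at \<open>x\<close>.\<close>

lemma energy_superharmonic: "(\<Sum>l\<in>L. W B (tau S l x) * energy (tau S l x)) \<le> energy x"
proof (rule field_le_epsilon)
  fix e :: real assume "0 < e"
  have "\<exists>F. finite F \<and> F \<subseteq> \<Lambda> \<and> energy (tau S l x) - e < partial_energy F (tau S l x)" for l
    using energy_approx[of "energy (tau S l x) - e" "tau S l x"] \<open>0 < e\<close> by force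
  then obtain F where F: "\<And>l. finite (F l)" "\<And>l. F l \<subseteq> \<Lambda>"
      "\<And>l. energy (tau S l x) - e < partial_energy (F l) (tau S l x)" by metis
  define G where "G = (\<Union>l\<in>L. F l)"
  define H where "H = (\<lambda>(t, l). S *v t + l) ` (G \<times> L)"
  have G: "finite G" "G \<subseteq> \<Lambda>" using F finite by (auto simp: G_def)
  have H: "finite H" "H \<subseteq> \<Lambda>" using G finite Lambda_step by (auto simp: H_def)
  have inj: "inj_on (\<lambda>(t, l). S *v t + l) (G \<times> L)"
    using inj_on_Lambda_L G(2) by (auto intro: inj_on_subset)
  have summand: "W B (tau S l x) * (cmod (fourier \<mu> (tau S l x + t)))\<^sup>2 = (cmod (fourier \<mu> (x + (S *v t + l))))\<^sup>2"
    if "t \<in> \<Lambda>" for t l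
  proof -
    have "Si (x + (S *v t + l)) = t + tau S l x"
      by (simp add: tau_S matrix_vector_right_distrib)
    then have "fourier \<mu> (x + (S *v t + l)) = mask B (tau S l x) * fourier \<mu> (t + tau S l x)"
      using fourier_refinement[of "x + (S *v t + l)"] mask_add_Ints[of B t] Lambda_inner_Ints[OF that] by simp
    then show ?thesis by (simp add: W_eq_mask norm_mult power_mult_distrib add.commute)
  qed
  \<comment> \<open>The weights sum to \<open>1\<close>, so lowering every value by \<open>e\<close>
    lowers the average by exactly \<open>e\<close>.\<close>
  have "(\<Sum>l\<in>L. W B (tau S l x) * energy (tau S l x)) - e
      = (\<Sum>l\<in>L. W B (tau S l x) * (energy (tau S l x) - e))"
    using sum_W_tau[of x] by (simp add: right_diff_distrib sum_subtractf flip: sum_distrib_right)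
  also have "\<dots> \<le> (\<Sum>l\<in>L. W B (tau S l x) * partial_energy G (tau S l x))"
  proof (intro sum_mono mult_left_mono)
    fix l assume "l \<in> L"
    then have "partial_energy (F l) (tau S l x) \<le> partial_energy G (tau S l x)"
      using G by (intro partial_energy_mono) (auto simp: G_def)
    then show "energy (tau S l x) - e \<le> partial_energy G (tau S l x)" using F(3)[of l] by linarith
  qed (simp add: W_def)
  also have "\<dots> = (\<Sum>l\<in>L. \<Sum>t\<in>G. (cmod (fourier \<mu> (x + (S *v t + l))))\<^sup>2)"
    using G(2) by (intro sum.cong refl) (auto simp: partial_energy_def sum_distrib_left summand intro!: sum.cong)
  also have "\<dots> = partial_energy H x"
    unfolding partial_energy_def H_def
    by (subst sum.reindex[OF inj], subst sum.swap) (simp add: sum.cartesian_product case_prod_beta)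
  also have "\<dots> \<le> energy x" using H by (rule partial_energy_le_energy)
  finally show "(\<Sum>l\<in>L. W B (tau S l x) * energy (tau S l x)) \<le> energy x + e" by linarith
qed

lemma W_nonneg: "0 \<le> W B x"
  by (simp add: W_def)

section \<open>The minimum of the energy on the attractor\<close>

text \<open>The weighted average of the nonnegative excesses over the minimum is at most
  \<open>0\<close>, so each excess of positive weight vanishes.\<close>

lemma energy_propagates:
  assumes min: "\<And>y. y \<in> X \<Longrightarrow> energy x \<le> energy y" and x: "x \<in> X"
    and l: "l \<in> L" "W B (tau S l x) \<noteq> 0"
  shows "energy (tau S l x) = energy x"
proof -
  let ?d = "\<lambda>l. W B (tau S l x) * (energy (tau S l x) - energy x)"
  have nonneg: "0 \<le> ?d l" if "l \<in> L" for l
    using min[OF tau_X[OF x that]] W_nonneg by simp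
  have "(\<Sum>l\<in>L. ?d l) \<le> 0"
    using energy_superharmonic[of x] sum_W_tau[of x]
    by (simp add: right_diff_distrib sum_subtractf flip: sum_distrib_right)
  then have "(\<Sum>l\<in>L. ?d l) = 0" using nonneg by (intro antisym sum_nonneg)
  then have "?d l = 0" using sum_nonneg_eq_0_iff[of L ?d] finite(2) nonneg l(1) by auto
  then show ?thesis using l(2) by simp
qed

lemma energy_ge_1_of_min_at_noncycle:
  assumes TZ: "TZ (W B) S L X"
    and min: "\<And>y. y \<in> X \<Longrightarrow> energy x \<le> energy y" and x: "x \<in> X" "\<not> cycle_point S L x"
  shows "1 \<le> energy x"
proof -
  have "\<exists>n\<^sub>x. \<forall>n\<ge>n\<^sub>x. \<forall>y\<in>preimages S L n x. W B y \<noteq> 0"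
    using conjunct1[OF TZ[unfolded TZ_def]] x by simp
  then obtain n0 where n0: "\<And>n y. n \<ge> n0 \<Longrightarrow> y \<in> preimages S L n x \<Longrightarrow> W B y \<noteq> 0"
    by blast
  \<comment> \<open>The probabilities sum to \<open>1\<close>, so some transition of positive
    probability always exists; this leads to minimum points of any depth.\<close>
  have ex: "\<exists>ls. set ls \<subseteq> L \<and> length ls = n \<and> energy (foldr (tau S) ls x) = energy x" for n
  proof (induction n)
    case 0
    show ?case by (intro exI[of _ "[]"]) simp
  next
    case (Suc n)
    then obtain ls where ls: "set ls \<subseteq> L" "length ls = n" "energy (foldr (tau S) ls x) = energy x"
      by blast
    let ?y = "foldr (tau S) ls x"
    have y: "?y \<in> X" using foldr_tau_X[OF x(1) ls(1)] .
    obtain l where l: "l \<in> L" "W B (tau S l ?y) \<noteq> 0"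
      using sum_W_tau[of ?y] by (metis sum.neutral zero_neq_one)
    have "energy (tau S l ?y) = energy ?y"
      by (rule energy_propagates[OF _ y l]) (simp add: ls(3) min)
    then show ?case using ls l by (intro exI[of _ "l # ls"]) simp
  qed
  from ex[of n0] obtain ls where ls: "set ls \<subseteq> L" "length ls = n0" "energy (foldr (tau S) ls x) = energy x"
    by blast
  \<comment> \<open>From depth \<open>n0\<close> on \<open>W\<close> has no zeroes among the
    descendants, so every digit is admissible, in particular the digit \<open>0\<close> forever.
    Digits prepended to the list are applied last.\<close>
  let ?y = "\<lambda>k. foldr (tau S) (replicate k 0 @ ls) x"
  have sub: "set (replicate k 0 @ ls) \<subseteq> L" for k
    using ls(1) zero(2) by (auto simp: set_replicate_conv_if)
  have const: "energy (?y k) = energy x" for k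
  proof (induction k)
    case 0
    show ?case using ls by simp
  next
    case (Suc k)
    have "?y (Suc k) \<in> preimages S L (Suc k + n0) x"
      unfolding preimages_def using sub[of "Suc k"] ls(2)
      by (intro CollectI exI[of _ "replicate (Suc k) 0 @ ls"]) simp
    then have W: "W B (?y (Suc k)) \<noteq> 0" using n0[of "Suc k + n0"] by simp
    have step: "?y (Suc k) = tau S 0 (?y k)" by simp
    have "energy (tau S 0 (?y k)) = energy (?y k)"
    proof (rule energy_propagates[OF _ foldr_tau_X[OF x(1) sub] zero(2)])
      show "energy (?y k) \<le> energy y" if "y \<in> X" for y
        unfolding Suc by (rule min[OF that])
      show "W B (tau S 0 (?y k)) \<noteq> 0" using W unfolding step .
    qed
    then show ?case unfolding step Suc .
  qed
  have "?y k = ((*v) (matrix_inv S) ^^ k) (foldr (tau S) ls x)" for k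
    unfolding foldr_append comp_apply foldr_tau_replicate_0 ..
  then have "?y \<longlonglongrightarrow> 0" using Si_iterates by (simp only: )
  \<comment> \<open>Lower semicontinuity bounds the energy at the limit \<open>0\<close> by the
    minimum, and this is the direction required.\<close>
  then have "0 \<in> {z. energy z \<le> energy x}"
    using closed_sequentially[OF closed_energy_sublevel[of "energy x"], of ?y 0] const by simp
  then show ?thesis using energy_ge_1_at_minus_Lambda[of 0] zero_in_Lambda by simp
qed

lemma energy_ge_1_of_min:
  assumes TZ: "TZ (W B) S L X"
    and min: "\<And>y. y \<in> X \<Longrightarrow> energy x \<le> energy y" and x: "x \<in> X"
  shows "1 \<le> energy x"
proof (cases "\<exists>y\<in>X. energy y = energy x \<and> \<not> cycle_point S L y")
  case True
  then show ?thesis using energy_ge_1_of_min_at_noncycle[OF TZ] min by metis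
next
  case False
  then have cyc: "cycle_point S L y" if "y \<in> X" "energy y = energy x" for y using that by blast
  obtain \<omega> p j where \<omega>: "\<omega> \<in> Omega L" "p \<ge> 1" "(shift ^^ p) \<omega> = \<omega>"
    and j: "x = coding S ((shift ^^ j) \<omega>)"
    using cyc[OF x refl] unfolding cycle_point_def is_cycle_def by blast
  define u where "u n = coding S ((shift ^^ n) \<omega>)" for n
  have tau_u: "tau S (\<omega> n) (u (Suc n)) = u n" for n
    unfolding u_def by (rule coding_funpow_step[OF \<omega>(1)])
  have \<omega>L: "\<omega> n \<in> L" for n using \<omega>(1) by (simp add: Omega_def)
  have descend: "u n \<in> X \<and> energy (u n) = energy x \<and> W B (u n) = 1"
    if u: "u (Suc n) \<in> X" "energy (u (Suc n)) = energy x" for n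
  proof -
    \<comment> \<open>A transition of positive probability leads to a minimum point, hence to a
      cycle point in this case. The second part of (TZ) excludes this for every digit except the one
      along the cycle.\<close>
    have W0: "W B (tau S l (u (Suc n))) = 0" if l: "l \<in> L" "l \<noteq> \<omega> n" for l
    proof (rule ccontr)
      assume nz: "W B (tau S l (u (Suc n))) \<noteq> 0"
      have "energy (tau S l (u (Suc n))) = energy (u (Suc n))"
        by (rule energy_propagates[OF _ u(1) l(1) nz]) (simp add: u(2) min)
      then have "cycle_point S L (tau S l (u (Suc n)))"
        using cyc[OF tau_X[OF u(1) l(1)]] u(2) by simp
      moreover have "(shift ^^ p) ((shift ^^ n) \<omega>) = (shift ^^ n) \<omega>"
        by (metis shift_funpow_add add.commute \<omega>(3))
      moreover have "((shift ^^ n) \<omega>) 0 = \<omega> n" by (simp add: shift_funpow)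
      moreover have "u (Suc n) = coding S (shift ((shift ^^ n) \<omega>))" by (simp add: u_def)
      ultimately show False
        using bspec[OF conjunct2[OF TZ[unfolded TZ_def]] Omega_shift_funpow[OF \<omega>(1), of n]] \<omega>(2) l nz
        by metis
    qed
    have "(\<Sum>l\<in>L. W B (tau S l (u (Suc n)))) = W B (tau S (\<omega> n) (u (Suc n)))"
      using W0 \<omega>L finite(2) by (subst sum.remove[of L "\<omega> n"]) auto
    then have W1: "W B (u n) = 1" using sum_W_tau[of "u (Suc n)"] tau_u by simp
    have "energy (tau S (\<omega> n) (u (Suc n))) = energy (u (Suc n))"
      by (rule energy_propagates[OF _ u(1) \<omega>L]) (simp_all add: u(2) min tau_u W1)
    then show ?thesis using W1 u tau_X[OF u(1) \<omega>L, of n] tau_u by simp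
  qed
  \<comment> \<open>Transitions lower the index. Starting at \<open>j + p\<close>, an index that
    again represents \<open>x\<close>, the descent passes through a full period of indices down to
    \<open>0\<close>.\<close>
  have all: "u n \<in> X \<and> energy (u n) = energy x" if "n \<le> j + p" for n
    using that
  proof (induction rule: inc_induct)
    case base
    have "u (j + p) = x" using \<omega>(3) by (simp add: u_def j funpow_add)
    then show ?case using x by simp
  next
    case (step n)
    then show ?case using descend by blast
  qed
  have W1: "W B (u n) = 1" if "n < p" for n
    using descend[of n] all[of "Suc n"] that by simp
  have "W_cycle B S L (coding S ` {(shift ^^ k) \<omega> | k. k < p})"
    unfolding W_cycle_def is_cycle_def using \<omega> W1 by (auto simp: u_def)
  moreover have "x \<in> coding S ` {(shift ^^ k) \<omega> | k. k < p}"
  proof -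
    have "(shift ^^ j) \<omega> = (shift ^^ (j mod p)) \<omega>" using funpow_mod_eq[OF \<omega>(3)] by simp
    moreover have "j mod p < p" using \<omega>(2) by simp
    ultimately show ?thesis unfolding j by auto
  qed
  ultimately obtain \<eta> where "W_periodic \<eta>" "x = coding S \<eta>"
    using W_cycle_imp_W_periodic by meson
  then have "- x \<in> \<Lambda>" using Lambda_W_periodic by simp
  then show ?thesis by (rule energy_ge_1_at_minus_Lambda)
qed

section \<open>From the attractor to the whole space\<close>

text \<open>Superharmonicity iterated \<open>n\<close> times: the energy is at least an average of
  its values after \<open>n\<close> transitions.\<close>

lemma energy_ge_of_preimages:
  assumes "\<And>ls. set ls \<subseteq> L \<Longrightarrow> length ls = n \<Longrightarrow> c \<le> energy (foldr (tau S) ls x)"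
  shows "c \<le> energy x"
  using assms
proof (induction n arbitrary: x)
  case 0
  then show ?case using 0[of "[]"] by simp
next
  case (Suc n)
  have "c \<le> energy (tau S l x)" if "l \<in> L" for l
  proof (rule Suc.IH)
    fix ls assume "set ls \<subseteq> L" "length ls = n"
    then show "c \<le> energy (foldr (tau S) ls (tau S l x))"
      \<comment> \<open>\<open>foldr\<close> applies the last letter of the list first, so the first
        transition is appended at the end.\<close>
      using Suc.prems[of "ls @ [l]"] that by simp
  qed
  then have "(\<Sum>l\<in>L. W B (tau S l x) * c) \<le> (\<Sum>l\<in>L. W B (tau S l x) * energy (tau S l x))"
    by (intro sum_mono mult_left_mono W_nonneg)
  then show ?case
    using energy_superharmonic[of x] sum_W_tau[of x] by (simp flip: sum_distrib_right)
qed

lemma energy_ge_1: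
  assumes TZ: "TZ (W B) S L X"
  shows "1 \<le> energy x"
proof (rule field_le_epsilon)
  fix e :: real assume "0 < e"
  obtain x0 where x0: "x0 \<in> X" "\<And>y. y \<in> X \<Longrightarrow> energy x0 \<le> energy y"
  proof (rule attains_min_closed_sublevels[OF compact_X X_nonempty closed_energy_sublevel])
    show "bdd_below (energy ` X)" using energy_nonneg by (intro bdd_belowI2)
  qed blast
  have on_X: "1 \<le> energy y" if "y \<in> X" for y
    using energy_ge_1_of_min[OF TZ x0(2,1)] x0(2)[OF that] by simp
  let ?V = "- {y. energy y \<le> 1 - e}"
  have "open ?V" using closed_energy_sublevel by blast
  moreover have "X \<subseteq> ?V" using on_X \<open>0 < e\<close> by fastforce
  \<comment> \<open>Lower semicontinuity gives energy above \<open>1 - e\<close> on a neighbourhood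
    of uniform radius \<open>d\<close> around the compact set \<open>X\<close>.\<close>
  ultimately obtain d where d: "d > 0" "(\<Union>y\<in>X. ball y d) \<subseteq> ?V"
    using compact_subset_open_imp_ball_epsilon_subset[OF compact_X] by metis
  obtain z where z: "z \<in> X" using X_nonempty by blast
  \<comment> \<open>One length \<open>n\<close> serves all words, because the difference of the
    images of \<open>z\<close> and \<open>x\<close> does not depend on the digits.\<close>
  obtain n where n: "norm (((*v) (matrix_inv S) ^^ n) (z - x)) < d"
    using LIMSEQ_D[OF Si_iterates d(1), of "z - x"] by auto
  have "1 - e \<le> energy x"
  proof (rule energy_ge_of_preimages)
    fix ls assume ls: "set ls \<subseteq> L" "length ls = n"
    have "dist (foldr (tau S) ls z) (foldr (tau S) ls x) < d"
      using n ls(2) by (simp add: dist_norm foldr_tau_diff)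
    then have "foldr (tau S) ls x \<in> ?V" using d(2) foldr_tau_X[OF z ls(1)] by (meson UN_I mem_ball subset_iff)
    then show "1 - e \<le> energy (foldr (tau S) ls x)" by simp
  qed
  then show "1 \<le> energy x + e" by linarith
qed

section \<open>Completeness and the orthonormal basis\<close>

lemma inj_on_expo_Lambda: "inj_on expo \<Lambda>"
proof (rule inj_onI)
  fix s t assume st: "s \<in> \<Lambda>" "t \<in> \<Lambda>" "expo s = expo t"
  have "expo (s - t) x = 1" for x
    using st(3) expo_add[of "s - t" t x] by simp (metis norm_expo norm_zero zero_neq_one)
  then have "fourier \<mu> (s - t) = 1" by (simp add: fourier_def prob_space)
  then show "s = t" using fourier_Lambda_diff[OF st(1,2)] by (auto split: if_splits)
qed

lemma L2_approx_expo:
  assumes TZ: "TZ (W B) S L X"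
  shows "L2_approx \<mu> {expo t | t. t \<in> \<Lambda>} (expo y)"
  unfolding L2_approx_def
proof (intro allI impI)
  fix \<epsilon> :: real assume "0 < \<epsilon>"
  then have "1 - \<epsilon> < energy (- y)" using energy_ge_1[OF TZ, of "- y"] by linarith
  then obtain F where F: "finite F" "F \<subseteq> \<Lambda>" "1 - \<epsilon> < partial_energy F (- y)"
    by (rule energy_approx)
  have inj: "inj_on expo F" using inj_on_expo_Lambda F(2) by (rule inj_on_subset)
  \<comment> \<open>Coefficients are indexed by functions, so the frequency is recovered by
    inverting \<open>expo\<close> on \<open>F\<close>.\<close>
  define c where "c g = fourier \<mu> (y - inv_into F expo g)" for g
  have "(\<Sum>g\<in>expo ` F. c g * g x) = (\<Sum>t\<in>F. fourier \<mu> (y - t) * expo t x)" for x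
    using inj by (simp add: sum.reindex c_def)
  then have "(LINT x|\<mu>. (cmod (expo y x - (\<Sum>g\<in>expo ` F. c g * g x)))\<^sup>2) < \<epsilon>"
    using norm_integral_expo_minus_projection[OF F(1,2), of y] F(3) by simp
  then show "\<exists>T c. finite T \<and> T \<subseteq> {expo t | t. t \<in> \<Lambda>} \<and>
      (LINT x|\<mu>. (cmod (expo y x - (\<Sum>g\<in>T. c g * g x)))\<^sup>2) < \<epsilon>"
    using F(1,2) by (intro exI[of _ "expo ` F"] exI[of _ c]) auto
qed

lemma orthonormal_basis:
  assumes TZ: "TZ (W B) S L X"
  shows "orthonormal_basis_L2 \<mu> {expo t | t. t \<in> \<Lambda>}"
proof -
  obtain K where K: "compact K" "measure \<mu> (- K) = 0"
    using mu by (auto simp: invariant_measure_def)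
  interpret borel_compact_support \<mu> K
    by unfold_locales (use sets_mu K in auto)
  let ?F = "{expo t | t. t \<in> \<Lambda>}"
  have F: "L2_fun \<mu> f" if "f \<in> ?F" for f using that L2_fun_expo by auto
  have "(LINT x|\<mu>. f x * cnj (g x)) = (if f = g then 1 else 0)" if fg: "f \<in> ?F" "g \<in> ?F" for f g
  proof -
    obtain s t where s: "s \<in> \<Lambda>" "f = expo s" and t: "t \<in> \<Lambda>" "g = expo t" using fg by auto
    have "f x * cnj (g x) = expo (s - t) x" for x
      using expo_add[of s "- t" x] by (simp add: s t cnj_expo)
    then have "(LINT x|\<mu>. f x * cnj (g x)) = fourier \<mu> (s - t)" by (simp add: fourier_def)
    also have "\<dots> = (if s = t then 1 else 0)" using s t by (simp add: fourier_Lambda_diff)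
    also have "s = t \<longleftrightarrow> f = g" using inj_on_expo_Lambda s t by (auto simp: inj_on_def)
    finally show ?thesis .
  qed
  moreover have "\<exists>T c. finite T \<and> T \<subseteq> ?F \<and> sqrt (LINT x|\<mu>. (cmod (h x - (\<Sum>f\<in>T. c f * f x)))\<^sup>2) < \<epsilon>"
    if h: "L2_fun \<mu> h" and "0 < \<epsilon>" for h \<epsilon>
  proof -
    \<comment> \<open>\<open>L2_approx\<close> bounds squared distances, so it is used with
      \<open>\<epsilon>\<^sup>2\<close> below.\<close>
    have "L2_approx \<mu> ?F h" by (rule L2_approx_all[OF F L2_approx_expo[OF TZ] h])
    then obtain T c where T: "finite T" "T \<subseteq> ?F"
        "(LINT x|\<mu>. (cmod (h x - (\<Sum>f\<in>T. c f * f x)))\<^sup>2) < \<epsilon>\<^sup>2"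
      using \<open>0 < \<epsilon>\<close> unfolding L2_approx_def by (meson zero_less_power)
    have "sqrt (LINT x|\<mu>. (cmod (h x - (\<Sum>f\<in>T. c f * f x)))\<^sup>2) < sqrt (\<epsilon>\<^sup>2)"
      using T(3) by (rule real_sqrt_less_mono)
    then show ?thesis using T(1,2) \<open>0 < \<epsilon>\<close> by (intro exI[of _ T] exI[of _ c]) simp
  qed
  ultimately show ?thesis unfolding orthonormal_basis_L2_def using F by blast
qed

end

theorem theorem8p4:
  fixes R S :: "real^'n^'n" and B L X :: "(real^'n) set" and \<mu> :: "(real^'n) measure"
  assumes expanding: "\<And>z. complex_eigenvalue R z \<Longrightarrow> cmod z > 1"
    and S: "S = transpose R"
    and finite: "finite B" "finite L"
    and card: "card B = card L"
    and unitary: "unitary_on B L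
          (\<lambda>b l. 1 / complex_of_real (sqrt (real (card B))) * expo (matrix_inv R *v b) l)"
    and integral: "\<And>b l n. b \<in> B \<Longrightarrow> l \<in> L \<Longrightarrow> (((*v) R ^^ n) b) \<bullet> l \<in> \<int>"
    and zero: "0 \<in> B" "0 \<in> L"
    and mu: "invariant_measure R B \<mu>"
    and X: "attractor S L X"
    and TZ: "TZ (W B) S L X"
  shows "orthonormal_basis_L2 \<mu> {expo t | t. t \<in> spectrum_set B S L}"
proof -
  interpret hadamard_ifs R S B L X \<mu>
    by unfold_locales (fact assms)+
  show ?thesis by (rule orthonormal_basis[OF TZ])
qed

end
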